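(* Let $\ell:[0,\infty)\to V_1$ be continuous and of bounded variation on compact intervals, and put $H[t]=H[\ell|_{[0,t]}]=\sum_{k=1}^nH_k[t]$ with $H_k[t]\in V_k$, and $U(t)=\exp H[t]\in G$. Let $T_j\to\infty$, and suppose that $\ell^\infty:[0,1]\to V_1$ is a macroscopic horizontal path along $(T_j)$. Put $U^\infty(u)=\exp H[\ell^\infty|_{[0,u]}]$. Then $$\delta_{1/T_j}U(T_ju)\longrightarrow U^\infty(u)$$ uniformly for $0\le u\le1$. Equivalently, for every $1\le k\le n$, $$\sup_{0\le u\le1}\left\|\frac{H_k[T_ju]}{T_j^k}-H_k\bigl[\ell^\infty|_{[0,u]}\bigr]\right\|\longrightarrow0 .$$ In particular, $$\delta_{1/T_j}H[T_j]\longrightarrow H[\ell^\infty],\qquad \delta_{1/T_j}U(T_j)\longrightarrow\exp H[\ell^\infty].$$ The final group element $\exp H[\ell^\infty]$ is the endpoint $U^\infty(1)$ of the developed macroscopic path and represents the limiting point of the developed endpoints $U(T_j)$ in the Carnot asymptotic cone along $(T_j)$.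
   Context: Graded setting. $\mathfrak g=V_1\oplus\cdots\oplus V_n$ is a finite-dimensional real graded $n$-step nilpotent Lie algebra: $[V_i,V_j]\subseteq V_{i+j}$, $V_k=\{0\}$ for $k>n$, generated as a Lie algebra by $V_1$, with a fixed norm $\|\cdot\|$. $G$ is the connected, simply connected Lie group with Lie algebra $\mathfrak g$; $\exp:\mathfrak g\to G$ is a global diffeomorphism. For $r>0$ the Carnot dilation is $\delta_r(v_1+\cdots+v_n)=rv_1+r^2v_2+\cdots+r^nv_n$ ($v_k\in V_k$), and also denotes the automorphism of $G$ with $\delta_r(\exp X)=\exp(\delta_rX)$. Bounded variation. $\operatorname{Var}(\gamma;[a,b])=\sup\sum_i\|\gamma(t_i)-\gamma(t_{i-1})\|$ over partitions of $[a,b]$; $\gamma$ has bounded variation (BV) if this is finite. Chacon–Fomenko Lie integral $H[\gamma]$ of a continuous BV path $\gamma:[a,b]\to V_1$. Define iterated Riemann–Stieltjes integrals $I_1(\gamma)_{s,t}=\gamma(t)-\gamma(s)$, $I_q(\gamma)_{s,t}=\int_s^t d\gamma(u)\otimes I_{q-1}(\gamma)_{s,u}\in V_1^{\otimes q}$ for $q\ge2$. Let $B_q:V_1^{\otimes q}\to V_q$ be the linear map with $B_1(v)=v$, $B_q(v_1\otimes\cdots\otimes v_q)=[\cdots[[v_1,v_2],v_3],\ldots,v_q]$, and put $T_j[\gamma]=B_{j+1}(I_{j+1}(\gamma)_{a,b})$, $j\ge0$. Let $k_{2p}=b_{2p}/(2p)!$ with $b_{2p}$ the Bernoulli numbers.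 Then $H[\gamma]=H_1[\gamma]+\cdots+H_n[\gamma]$, $H_k[\gamma]\in V_k$, is defined by $H_1[\gamma]=T_0[\gamma]=\gamma(b)-\gamma(a)$ and, for $k\ge1$, $$(k+1)H_{k+1}[\gamma]=T_k[\gamma]+\sum_{r=1}^k\Big\{\tfrac12[H_r[\gamma],T_{k-r}[\gamma]]+\sum_{p\ge1,\,2p\le r}k_{2p}\sum_{m_i>0,\;m_1+\cdots+m_{2p}=r}[H_{m_1}[\gamma],[\cdots[H_{m_{2p}}[\gamma],T_{k-r}[\gamma]]\cdots]]\Big\}.$$ Macroscopic path. For $T>0$ put $\ell_T(u)=(\ell(Tu)-\ell(0))/T$, $0\le u\le1$. A continuous BV path $\ell^\infty:[0,1]\to V_1$ is a macroscopic horizontal path along $(T_j)$ if $\ell_{T_j}\to\ell^\infty$ uniformly on $[0,1]$ and $\sup_j\operatorname{Var}(\ell_{T_j};[0,1])<\infty$. The path $U^\infty$ is called the developed macroscopic path. Convergence and cone. Uniform convergence of $G$-valued paths on $[0,1]$ is with respect to any metric inducing the manifold topology of $G$. The Carnot asymptotic cone is represented by $G$ itself: with $d_{\mathrm{CC}}$ the left-invariant Carnot–Carathéodory distance determined by $V_1$ and its norm, $\delta_{1/T}:(G,e,T^{-1}d_{\mathrm{CC}})\to(G,e,d_{\mathrm{CC}})$ is a pointed isometry, and the representative of a point $g_T\in G$ in the blow-down at scale $T$ is $\delta_{1/T}g_T$; the limiting point along $(T_j)$ is $\lim_j\delta_{1/T_j}g_{T_j}$. *)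

theory Defs
  imports "HOL-Analysis.Analysis" "HOL-Algebra.Group"
begin

section \<open>Graded Lie algebras\<close>

definition lie_subalgebra :: "('a::real_vector \<Rightarrow> 'a \<Rightarrow> 'a) \<Rightarrow> 'a set \<Rightarrow> bool" where
  "lie_subalgebra br S \<longleftrightarrow> subspace S \<and> (\<forall>x\<in>S. \<forall>y\<in>S. br x y \<in> S)"

definition is_grading :: "nat \<Rightarrow> (nat \<Rightarrow> 'a::real_vector set) \<Rightarrow> 'a \<Rightarrow> (nat \<Rightarrow> 'a) \<Rightarrow> bool" where
  "is_grading n V x v \<longleftrightarrow>
     (\<forall>k\<in>{1..n}. v k \<in> V k) \<and> (\<forall>k. k \<notin> {1..n} \<longrightarrow> v k = 0) \<and> x = (\<Sum>k=1..n. v k)"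

text \<open>The Lie algebra is the whole type, with bracket \<open>br\<close>; its fixed norm is that of the type,
  which need not come from an inner product. The layers are \<open>V 1, \<dots>, V n\<close>; \<open>V 0\<close> plays no role.\<close>

locale graded_lie_algebra =
  fixes n :: nat
    and br :: "'a::real_normed_vector \<Rightarrow> 'a \<Rightarrow> 'a"
    and V :: "nat \<Rightarrow> 'a set"
  assumes finite_dim: "\<exists>B::'a set. finite B \<and> span B = UNIV"
    and step_pos: "1 \<le> n"
    and bilinear: "bilinear br"
    and alternating: "\<And>x. br x x = 0"
    and jacobi: "\<And>x y z. br x (br y z) + br y (br z x) + br z (br x y) = 0"
    and subspace_layer: "\<And>k. 1 \<le> k \<Longrightarrow> subspace (V k)"
    and trivial_layer: "\<And>k. n < k \<Longrightarrow> V k = {0}"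
    and direct_sum: "\<And>x. \<exists>!v. is_grading n V x v"
    and bracket_layer: "\<And>i j x y. 1 \<le> i \<Longrightarrow> 1 \<le> j \<Longrightarrow> x \<in> V i \<Longrightarrow> y \<in> V j \<Longrightarrow> br x y \<in> V (i + j)"
    and generated: "lie_subalgebra br hull V 1 = UNIV"

definition layer_part :: "nat \<Rightarrow> (nat \<Rightarrow> 'a::real_vector set) \<Rightarrow> nat \<Rightarrow> 'a \<Rightarrow> 'a" where
  "layer_part n V k x = (THE v. is_grading n V x v) k"

definition dilation :: "nat \<Rightarrow> (nat \<Rightarrow> 'a::real_vector set) \<Rightarrow> real \<Rightarrow> 'a \<Rightarrow> 'a" where
  "dilation n V r x = (\<Sum>k=1..n. r ^ k *\<^sub>R layer_part n V k x)"


section \<open>The simply connected Lie group of a nilpotent Lie algebra\<close>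

text \<open>For maps between finite-dimensional spaces this is the usual class \<open>C\<^sup>k\<close>.\<close>

primrec cont_diff :: "nat \<Rightarrow> ('a::real_normed_vector \<Rightarrow> 'b::real_normed_vector) \<Rightarrow> bool" where
  "cont_diff 0 f \<longleftrightarrow> continuous_on UNIV f"
| "cont_diff (Suc k) f \<longleftrightarrow>
     (\<forall>x. f differentiable (at x)) \<and> (\<forall>v. cont_diff k (\<lambda>x. frechet_derivative f (at x) v))"

definition smooth :: "('a::real_normed_vector \<Rightarrow> 'b::real_normed_vector) \<Rightarrow> bool" where
  "smooth f \<longleftrightarrow> (\<forall>k. cont_diff k f)"

definition log_mult :: "('g, 'x) monoid_scheme \<Rightarrow> ('a \<Rightarrow> 'g) \<Rightarrow> 'a \<Rightarrow> 'a \<Rightarrow> 'a" where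
  "log_mult G Exp x y = inv_into UNIV Exp (Exp x \<otimes>\<^bsub>G\<^esub> Exp y)"

text \<open>The left-invariant vector field with value \<open>v\<close> at the identity, in the global chart given by
  the inverse of \<open>Exp\<close>.\<close>

definition left_field ::
    "('g, 'x) monoid_scheme \<Rightarrow> ('a::real_normed_vector \<Rightarrow> 'g) \<Rightarrow> 'a \<Rightarrow> 'a \<Rightarrow> 'a" where
  "left_field G Exp v x = vector_derivative (\<lambda>t. log_mult G Exp x (t *\<^sub>R v)) (at 0)"

text \<open>Since the exponential map of a connected, simply connected nilpotent Lie group is a global
  diffeomorphism, the manifold structure of \<open>G\<close> is the one transported from the Lie algebra by
  \<open>Exp\<close>; \<open>X\<close> is the manifold topology, so that \<open>G\<close> is automatically connected and simply connected.
  \<open>smooth_mult\<close> and \<open>one_parameter\<close> say that \<open>G\<close> is a Lie group (inversion is \<open>x \<mapsto> - x\<close> in the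
  chart) and that \<open>Exp\<close> is its exponential map; \<open>lie_bracket\<close> says that \<open>br\<close> is the commutator
  \<open>[A, B] = DB A - DA B\<close> of left-invariant vector fields, evaluated at the identity.\<close>

locale graded_lie_group = graded_lie_algebra n br V
  for n :: nat
    and br :: "'a::real_normed_vector \<Rightarrow> 'a \<Rightarrow> 'a"
    and V :: "nat \<Rightarrow> 'a set" +
  fixes G :: "('g, 'x) monoid_scheme"
    and X :: "'g topology"
    and Exp :: "'a \<Rightarrow> 'g"
  assumes group: "group G"
    and topspace: "topspace X = carrier G"
    and homeomorphic: "homeomorphic_map euclidean X Exp"
    and smooth_mult: "smooth (\<lambda>(x, y). log_mult G Exp x y)"
    and one_parameter: "\<And>s t x. Exp ((s + t) *\<^sub>R x) = Exp (s *\<^sub>R x) \<otimes>\<^bsub>G\<^esub> Exp (t *\<^sub>R x)"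
    and lie_bracket: "\<And>x y. br x y =
          frechet_derivative (left_field G Exp y) (at 0) x
        - frechet_derivative (left_field G Exp x) (at 0) y"

definition group_dilation ::
    "nat \<Rightarrow> (nat \<Rightarrow> 'a::real_vector set) \<Rightarrow> ('a \<Rightarrow> 'g) \<Rightarrow> real \<Rightarrow> 'g \<Rightarrow> 'g" where
  "group_dilation n V Exp r g = Exp (dilation n V r (inv_into UNIV Exp g))"

text \<open>The Carnot asymptotic cone is represented by \<open>G\<close> itself: the blow-down at scale \<open>T\<close> is
  identified with \<open>G\<close> by the dilation of ratio \<open>1 / T\<close>, which is a pointed isometry for the
  Carnot--Caratheodory distance (rescaled by \<open>1 / T\<close> on the source), and the limiting point along a
  sequence of scales is the limit of the representatives in \<open>G\<close>.\<close>

definition cone_limit_point ::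
    "nat \<Rightarrow> (nat \<Rightarrow> 'a::real_vector set) \<Rightarrow> 'g topology \<Rightarrow> ('a \<Rightarrow> 'g)
      \<Rightarrow> (nat \<Rightarrow> real) \<Rightarrow> (nat \<Rightarrow> 'g) \<Rightarrow> 'g \<Rightarrow> bool" where
  "cone_limit_point n V X Exp T g x \<longleftrightarrow>
     limitin X (\<lambda>j. group_dilation n V Exp (1 / T j) (g j)) x sequentially"


section \<open>Variation and Riemann--Stieltjes integrals\<close>

definition variation :: "(real \<Rightarrow> 'a::real_normed_vector) \<Rightarrow> real \<Rightarrow> real \<Rightarrow> ennreal" where
  "variation \<gamma> a b =
     (SUP D\<in>{D. D division_of {a..b}}. \<Sum>K\<in>D. ennreal (norm (\<gamma> (Sup K) - \<gamma> (Inf K))))"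

definition bounded_var :: "(real \<Rightarrow> 'a::real_normed_vector) \<Rightarrow> real \<Rightarrow> real \<Rightarrow> bool" where
  "bounded_var \<gamma> a b \<longleftrightarrow> variation \<gamma> a b < \<infinity>"

definition has_rs_integral ::
    "(real \<Rightarrow> real) \<Rightarrow> (real \<Rightarrow> real) \<Rightarrow> real \<Rightarrow> real \<Rightarrow> real \<Rightarrow> bool" where
  "has_rs_integral f g a b I \<longleftrightarrow>
     (\<forall>\<epsilon>>0. \<exists>\<delta>>0. \<forall>P. P tagged_division_of {a..b} \<and> (\<forall>(u, K)\<in>P. Sup K - Inf K < \<delta>) \<longrightarrow>
        \<bar>(\<Sum>(u, K)\<in>P. f u * (g (Sup K) - g (Inf K))) - I\<bar> < \<epsilon>)"

definition rs_integral :: "(real \<Rightarrow> real) \<Rightarrow> (real \<Rightarrow> real) \<Rightarrow> real \<Rightarrow> real \<Rightarrow> real" where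
  "rs_integral f g a b = (THE I. has_rs_integral f g a b I)"


section \<open>Tensors and iterated integrals\<close>

text \<open>For a finite-dimensional space \<open>W\<close>, an element of the \<open>q\<close>-th tensor power of \<open>W\<close> is
  encoded as the multilinear form it induces on \<open>q\<close>-tuples (lists of length \<open>q\<close>) of linear
  functionals on \<open>W\<close>.\<close>

type_synonym 'a tensor = "('a \<Rightarrow> real) list \<Rightarrow> real"

definition pure_tensor :: "'a list \<Rightarrow> 'a tensor" where
  "pure_tensor vs \<phi>s = (\<Prod>(\<phi>, v)\<leftarrow>zip \<phi>s vs. \<phi> v)"

text \<open>\<open>iter_integral \<gamma> s t \<phi>s\<close> is the value on \<open>\<phi>s\<close> of the iterated integral of order
  \<open>length \<phi>s\<close>; the first tensor factor is the outermost (latest) increment. As the tensor powers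
  are finite-dimensional, the tensor-valued integral is the componentwise one.\<close>

fun iter_integral :: "(real \<Rightarrow> 'a::real_normed_vector) \<Rightarrow> real \<Rightarrow> real \<Rightarrow> 'a tensor" where
  "iter_integral \<gamma> s t [] = 1"
| "iter_integral \<gamma> s t [\<phi>] = \<phi> (\<gamma> t - \<gamma> s)"
| "iter_integral \<gamma> s t (\<phi> # \<psi> # \<phi>s) =
     rs_integral (\<lambda>u. iter_integral \<gamma> s u (\<psi> # \<phi>s)) (\<lambda>u. \<phi> (\<gamma> u)) s t"

fun left_bracket :: "('a::real_vector \<Rightarrow> 'a \<Rightarrow> 'a) \<Rightarrow> 'a list \<Rightarrow> 'a" where
  "left_bracket br [] = 0"
| "left_bracket br (v # vs) = foldl br v vs"

definition some_basis :: "'a::real_vector set \<Rightarrow> 'a set" where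
  "some_basis W = (SOME E. independent E \<and> span E = W)"

text \<open>The linear map \<open>B\<^sub>q\<close> on the \<open>q\<close>-th tensor power of \<open>W\<close>, by expansion in a basis of \<open>W\<close> and
  its dual basis. It is determined by its values on pure tensors, see \<open>tensor_bracket_pure\<close> below,
  so the choice of the basis is immaterial.\<close>

definition tensor_bracket ::
    "('a::real_vector \<Rightarrow> 'a \<Rightarrow> 'a) \<Rightarrow> 'a set \<Rightarrow> nat \<Rightarrow> 'a tensor \<Rightarrow> 'a" where
  "tensor_bracket br W q \<tau> =
     (\<Sum>w | set w \<subseteq> some_basis W \<and> length w = q.
        \<tau> (map (\<lambda>e v. representation (some_basis W) v e) w) *\<^sub>R left_bracket br w)"

lemma some_basis:
  fixes W :: "'a::real_vector set"
  assumes "subspace W"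
  shows "independent (some_basis W)" "span (some_basis W) = W"
proof -
  obtain E where "E \<subseteq> W" "independent E" "W \<subseteq> span E"
    using maximal_independent_subset by blast
  then have "\<exists>E. independent E \<and> span E = W"
    using assms span_minimal by blast
  then show "independent (some_basis W)" "span (some_basis W) = W"
    unfolding some_basis_def by (metis (mono_tags, lifting) someI_ex)+
qed

lemma tensor_bracket_pure:
  fixes W :: "'a::real_vector set"
  assumes fin: "\<exists>B::'a set. finite B \<and> span B = UNIV"
    and W: "subspace W" and br: "bilinear br"
    and vs: "set vs \<subseteq> W"
  shows "tensor_bracket br W (length vs) (pure_tensor vs) = left_bracket br vs"
proof -
  define E where "E = some_basis W"
  have E: "independent E" "span E = W"
    unfolding E_def using some_basis[OF W] by auto
  obtain B :: "'a set" where "finite B" "span B = UNIV" using fin by blast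
  then have finE: "finite E"
    using independent_span_bound[OF _ E(1), of B] by auto
  define \<phi> where "\<phi> = (\<lambda>e v. representation E v e)"
  have rep: "(\<Sum>e\<in>E. \<phi> e v *\<^sub>R e) = v" if "v \<in> W" for v
    unfolding \<phi>_def using E finE that by (intro sum_representation_eq) auto
  define Wd where "Wd = (\<lambda>q. {w. set w \<subseteq> E \<and> length w = q})"
  have finWd: "finite (Wd q)" for q
    unfolding Wd_def using finE by (rule finite_lists_length_eq)
  have br1: "br (\<Sum>i\<in>A. f i) y = (\<Sum>i\<in>A. br (f i) y)"
    and br2: "br x (\<Sum>i\<in>A. g i) = (\<Sum>i\<in>A. br x (g i))" for A f g x y
    using br linear_sum[of "\<lambda>x. br x y" f A] linear_sum[of "br x" g A]
    unfolding bilinear_def by simp_all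
  have *: "(\<Sum>w\<in>Wd (length vs). pure_tensor vs (map \<phi> w) *\<^sub>R left_bracket br w) = left_bracket br vs"
    if "vs \<noteq> []" "set vs \<subseteq> W"
    using that
  proof (induction vs rule: rev_nonempty_induct)
    case (single v)
    have "Wd 1 = (\<lambda>e. [e]) ` E"
      by (auto simp: Wd_def length_Suc_conv)
    then show ?case
      using rep[of v] single
      by (simp add: sum.reindex inj_on_def pure_tensor_def)
  next
    case (snoc v us)
    let ?q = "length us"
    have q: "?q > 0" using snoc by simp
    have Wd: "Wd (Suc ?q) = (\<lambda>(w, e). w @ [e]) ` (Wd ?q \<times> E)"
      by (auto simp: Wd_def length_Suc_conv_rev)
    have inj: "inj_on (\<lambda>(w, e). w @ [e]) (Wd ?q \<times> E)"
      by (auto simp: inj_on_def)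
    have lb: "left_bracket br (w @ [e]) = br (left_bracket br w) e" if "w \<noteq> []" for w e
      using that by (cases w) auto
    have pt: "pure_tensor (us @ [v]) (map \<phi> (w @ [e])) = pure_tensor us (map \<phi> w) * \<phi> e v"
      if "w \<in> Wd ?q" for w e
      using that by (simp add: pure_tensor_def Wd_def)
    have "(\<Sum>w\<in>Wd (length (us @ [v])). pure_tensor (us @ [v]) (map \<phi> w) *\<^sub>R left_bracket br w)
       = (\<Sum>(w, e)\<in>Wd ?q \<times> E. pure_tensor (us @ [v]) (map \<phi> (w @ [e])) *\<^sub>R left_bracket br (w @ [e]))"
      unfolding length_append_singleton Wd
      by (subst sum.reindex[OF inj]) (simp add: case_prod_unfold o_def)
    also have "\<dots> = (\<Sum>(w, e)\<in>Wd ?q \<times> E.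
        br (pure_tensor us (map \<phi> w) *\<^sub>R left_bracket br w) (\<phi> e v *\<^sub>R e))"
    proof (intro sum.cong refl, clarify)
      fix w e assume w: "w \<in> Wd ?q"
      then have ne: "w \<noteq> []" using q by (auto simp: Wd_def)
      show "pure_tensor (us @ [v]) (map \<phi> (w @ [e])) *\<^sub>R left_bracket br (w @ [e])
        = br (pure_tensor us (map \<phi> w) *\<^sub>R left_bracket br w) (\<phi> e v *\<^sub>R e)"
        by (simp only: pt[OF w] lb[OF ne] bilinear_lmul[OF br] bilinear_rmul[OF br]
          scaleR_scaleR mult.commute)
    qed
    also have "\<dots> = br (\<Sum>w\<in>Wd ?q. pure_tensor us (map \<phi> w) *\<^sub>R left_bracket br w)
                       (\<Sum>e\<in>E. \<phi> e v *\<^sub>R e)"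
      unfolding br1 unfolding br2 by (simp add: sum.cartesian_product)
    also have "\<dots> = br (left_bracket br us) v"
      using snoc rep[of v] by auto
    also have "\<dots> = left_bracket br (us @ [v])"
      using snoc by (simp add: lb)
    finally show ?case .
  qed
  show ?thesis
  proof (cases "vs = []")
    case True
    then show ?thesis by (simp add: tensor_bracket_def)
  next
    case False
    then show ?thesis
      using * vs unfolding tensor_bracket_def Wd_def \<phi>_def E_def by simp
  qed
qed


section \<open>The Lie integral\<close>

text \<open>Bernoulli numbers, \<open>z / (exp z - 1) = (\<Sum>m. bernoulli m * z ^ m / fact m)\<close>.\<close>

fun bernoulli :: "nat \<Rightarrow> real" where
  "bernoulli m = (if m = 0 then 1
     else - (\<Sum>k<m. real (Suc m choose k) * bernoulli k) / real (Suc m))"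

declare bernoulli.simps [simp del]

definition lie_T ::
    "('a::real_normed_vector \<Rightarrow> 'a \<Rightarrow> 'a) \<Rightarrow> 'a set \<Rightarrow> (real \<Rightarrow> 'a) \<Rightarrow> real \<Rightarrow> real \<Rightarrow> nat \<Rightarrow> 'a" where
  "lie_T br W \<gamma> a b j = tensor_bracket br W (Suc j) (iter_integral \<gamma> a b)"

text \<open>For \<open>k = 0\<close> the second equation reads \<open>H 1 = T 0\<close>.\<close>

function lie_rec :: "('a::real_vector \<Rightarrow> 'a \<Rightarrow> 'a) \<Rightarrow> (nat \<Rightarrow> 'a) \<Rightarrow> nat \<Rightarrow> 'a" where
  "lie_rec br T 0 = 0"
| "lie_rec br T (Suc k) = (1 / real (Suc k)) *\<^sub>R
     (T k + (\<Sum>r=1..k.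
        (1 / 2) *\<^sub>R br (lie_rec br T r) (T (k - r))
      + (\<Sum>p | 1 \<le> p \<and> 2 * p \<le> r. (bernoulli (2 * p) / fact (2 * p)) *\<^sub>R
          (\<Sum>ms | length ms = 2 * p \<and> (\<forall>m\<in>set ms. 0 < m) \<and> sum_list ms = r.
             foldr (\<lambda>m y. br (lie_rec br T m) y) ms (T (k - r))))))"
  by pat_completeness auto
termination
  by (relation "Wellfounded.measure (\<lambda>(br, T, k). k)") (auto dest: member_le_sum_list)

text \<open>\<open>lie_integral_part br V \<gamma> a b k\<close> and \<open>lie_integral n br V \<gamma> a b\<close> are \<open>H\<^sub>k\<close> and \<open>H\<close> of the
  restriction of \<open>\<gamma>\<close> to \<open>{a..b}\<close>.\<close>

definition lie_integral_part ::
    "('a::real_normed_vector \<Rightarrow> 'a \<Rightarrow> 'a) \<Rightarrow> (nat \<Rightarrow> 'a set) \<Rightarrow> (real \<Rightarrow> 'a)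
      \<Rightarrow> real \<Rightarrow> real \<Rightarrow> nat \<Rightarrow> 'a" where
  "lie_integral_part br V \<gamma> a b k = lie_rec br (lie_T br (V 1) \<gamma> a b) k"

definition lie_integral ::
    "nat \<Rightarrow> ('a::real_normed_vector \<Rightarrow> 'a \<Rightarrow> 'a) \<Rightarrow> (nat \<Rightarrow> 'a set) \<Rightarrow> (real \<Rightarrow> 'a)
      \<Rightarrow> real \<Rightarrow> real \<Rightarrow> 'a" where
  "lie_integral n br V \<gamma> a b = (\<Sum>k=1..n. lie_integral_part br V \<gamma> a b k)"

definition developed_path ::
    "nat \<Rightarrow> ('a::real_normed_vector \<Rightarrow> 'a \<Rightarrow> 'a) \<Rightarrow> (nat \<Rightarrow> 'a set) \<Rightarrow> ('a \<Rightarrow> 'g)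
      \<Rightarrow> (real \<Rightarrow> 'a) \<Rightarrow> real \<Rightarrow> 'g" where
  "developed_path n br V Exp \<gamma> t = Exp (lie_integral n br V \<gamma> 0 t)"


section \<open>Macroscopic paths\<close>

definition rescaled :: "(real \<Rightarrow> 'a::real_vector) \<Rightarrow> real \<Rightarrow> real \<Rightarrow> 'a" where
  "rescaled \<gamma> T u = (\<gamma> (T * u) - \<gamma> 0) /\<^sub>R T"

definition macroscopic_path ::
    "(nat \<Rightarrow> 'a::real_normed_vector set) \<Rightarrow> (real \<Rightarrow> 'a) \<Rightarrow> (nat \<Rightarrow> real) \<Rightarrow> (real \<Rightarrow> 'a) \<Rightarrow> bool" where
  "macroscopic_path V \<gamma> T \<gamma>' \<longleftrightarrow>
     continuous_on {0..1} \<gamma>' \<and> \<gamma>' ` {0..1} \<subseteq> V 1 \<and> bounded_var \<gamma>' 0 1 \<and>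
     uniform_limit {0..1} (\<lambda>j. rescaled \<gamma> (T j)) \<gamma>' sequentially \<and>
     (SUP j. variation (rescaled \<gamma> (T j)) 0 1) < \<infinity>"

end

theory Submission
  imports Defs
begin

text \<open>The iterated integrals of a rescaled path are homogeneous, and the recursion for \<open>H\<^sub>k\<close> has
  weight \<open>k\<close>, so \<open>H\<^sub>k[T u] / T\<^sup>k\<close> is \<open>H\<^sub>k\<close> of the rescaled path on \<open>[0, u]\<close>. It then suffices that
  iterated integrals, hence by finite-dimensionality and continuity of the bracket the \<open>H\<^sub>k\<close>, are
  stable under uniform convergence of paths of uniformly bounded variation. For one Riemann--Stieltjes
  integral this follows by approximating the integrand uniformly by a polynomial, at a cost
  controlled by the variation, and integrating by parts, after which the integrator enters only
  through its values. Uniform convergence in the Lie algebra passes to the group because \<open>Exp\<close> is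
  continuous and the limit path has compact image.\<close>

section \<open>Riemann--Stieltjes integrals with continuous integrators of bounded variation\<close>

text \<open>The obstacle is that uniform convergence with bounded variations does not make the
  variations converge, nor the variation of the difference tend to \<open>0\<close>: small fast
  oscillations survive in it. Hence two integrators are never compared in variation; the polynomial
  is chosen once, for the limit integrand, so that the bounds on it and on its derivative do not
  depend on the index. The induction on the order of an iterated integral closes because the
  integrand is asked only to be continuous in the upper endpoint and to converge uniformly in it;
  the variation bound is asked of the integrator, which is always a coordinate of the path itself.
  Since \<open>rs_integral\<close> is a definite description, existence of the integral has to be
  established as well, and the same approximation gives it. Two smaller gaps concern coordinates:
  those given by \<open>representation\<close> vanish off \<open>V 1\<close> and are replaced by
  bounded functionals on the whole space that agree with them on \<open>V 1\<close>; and as the norm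
  is arbitrary, boundedness of linear maps is derived from compactness of a coordinate box.\<close>

definition rs_sum :: "(real \<Rightarrow> real) \<Rightarrow> (real \<Rightarrow> real) \<Rightarrow> (real \<times> real set) set \<Rightarrow> real" where
  "rs_sum f g P = (\<Sum>(u, K)\<in>P. f u * (g (Sup K) - g (Inf K)))"

text \<open>A real bound over the same tagged divisions that index the sums \<open>rs_sum\<close>,
  so that it combines directly with a bound of the integrand, and one \<open>M\<close> can serve a
  whole family of integrators.\<close>

definition variation_le :: "(real \<Rightarrow> real) \<Rightarrow> real \<Rightarrow> real \<Rightarrow> real \<Rightarrow> bool" where
  "variation_le g a b M \<longleftrightarrow>
     (\<forall>P. P tagged_division_of {a..b} \<longrightarrow> (\<Sum>(u, K)\<in>P. \<bar>g (Sup K) - g (Inf K)\<bar>) \<le> M)"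

text \<open>The tag makes the cell nonempty, and this is what turns \<open>Inf K\<close> and
  \<open>Sup K\<close> into its endpoints.\<close>

lemma tagged_division_of_real_cell:
  fixes a b :: real
  assumes "P tagged_division_of {a..b}" "(u, K) \<in> P"
  obtains s t where "K = {s..t}" "a \<le> s" "s \<le> u" "u \<le> t" "t \<le> b" "Inf K = s" "Sup K = t"
proof -
  obtain s t where K: "K = {s..t}" "u \<in> K" "K \<subseteq> {a..b}"
    using tagged_division_ofD(2,3,4)[OF assms] by auto
  then have "s \<le> t" by auto
  with K show thesis by (intro that[of s t]) auto
qed

text \<open>Cousin's lemma for a constant gauge. It keeps the limit over small meshes from being
  vacuous, hence makes integrals unique.\<close>

lemma tagged_division_small_mesh:
  fixes a b \<delta> :: real
  assumes "0 < \<delta>"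
  obtains P where "P tagged_division_of {a..b}" "\<forall>(u, K)\<in>P. Sup K - Inf K < \<delta>"
proof -
  have "gauge (\<lambda>x::real. ball x (\<delta>/2))" using assms by (intro gauge_ball) auto
  then obtain P where P: "P tagged_division_of {a..b}" "(\<lambda>x. ball x (\<delta>/2)) fine P"
    using fine_division_exists_real by blast
  have "Sup K - Inf K < \<delta>" if K: "(u, K) \<in> P" for u K
  proof -
    obtain s t where st: "K = {s..t}" "a \<le> s" "s \<le> u" "u \<le> t" "t \<le> b" "Inf K = s" "Sup K = t"
      using tagged_division_of_real_cell[OF P(1) K] by metis
    have "K \<subseteq> ball u (\<delta>/2)" using fineD[OF P(2) K] .
    then have "s \<in> ball u (\<delta>/2)" "t \<in> ball u (\<delta>/2)"
      using st(1) order_trans[OF st(3,4)] by (auto simp only: subset_iff atLeastAtMost_iff)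
    then show ?thesis using st by (auto simp: dist_real_def)
  qed
  with P(1) show thesis by (intro that) auto
qed

lemma has_rs_integral_rs_sum:
  "has_rs_integral f g a b I \<longleftrightarrow>
     (\<forall>\<epsilon>>0. \<exists>\<delta>>0. \<forall>P. P tagged_division_of {a..b} \<and> (\<forall>(u, K)\<in>P. Sup K - Inf K < \<delta>) \<longrightarrow>
        \<bar>rs_sum f g P - I\<bar> < \<epsilon>)"
  unfolding has_rs_integral_def rs_sum_def ..

lemma has_rs_integralE:
  assumes "has_rs_integral f g a b I" "0 < \<epsilon>"
  obtains \<delta> where "0 < \<delta>"
    "\<And>P. P tagged_division_of {a..b} \<Longrightarrow> \<forall>(u, K)\<in>P. Sup K - Inf K < \<delta> \<Longrightarrow> \<bar>rs_sum f g P - I\<bar> < \<epsilon>"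
  using assms(1)[unfolded has_rs_integral_rs_sum, rule_format, OF assms(2)]
  by (elim exE conjE) (rule that, blast+)

lemma rs_sum_diff: "rs_sum (\<lambda>x. f x - h x) g P = rs_sum f g P - rs_sum h g P"
  unfolding rs_sum_def by (simp add: case_prod_unfold sum_subtractf left_diff_distrib)

lemma has_rs_integral_diff:
  assumes "has_rs_integral f g a b I" "has_rs_integral h g a b J"
  shows "has_rs_integral (\<lambda>x. f x - h x) g a b (I - J)"
  unfolding has_rs_integral_rs_sum
proof (intro allI impI)
  fix \<epsilon> :: real assume "0 < \<epsilon>"
  then have e2: "0 < \<epsilon>/2" by simp
  obtain d1 where d1: "0 < d1"
    and 1: "\<And>P. P tagged_division_of {a..b} \<Longrightarrow> \<forall>(u, K)\<in>P. Sup K - Inf K < d1 \<Longrightarrow> \<bar>rs_sum f g P - I\<bar> < \<epsilon>/2"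
    using has_rs_integralE[OF assms(1) e2] by blast
  obtain d2 where d2: "0 < d2"
    and 2: "\<And>P. P tagged_division_of {a..b} \<Longrightarrow> \<forall>(u, K)\<in>P. Sup K - Inf K < d2 \<Longrightarrow> \<bar>rs_sum h g P - J\<bar> < \<epsilon>/2"
    using has_rs_integralE[OF assms(2) e2] by blast
  show "\<exists>\<delta>>0. \<forall>P. P tagged_division_of {a..b} \<and> (\<forall>(u, K)\<in>P. Sup K - Inf K < \<delta>) \<longrightarrow>
    \<bar>rs_sum (\<lambda>x. f x - h x) g P - (I - J)\<bar> < \<epsilon>"
  proof (intro exI[of _ "min d1 d2"] conjI allI impI)
    fix P assume P: "P tagged_division_of {a..b} \<and> (\<forall>(u, K)\<in>P. Sup K - Inf K < min d1 d2)"
    have "\<bar>rs_sum f g P - I\<bar> < \<epsilon>/2" "\<bar>rs_sum h g P - J\<bar> < \<epsilon>/2"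
      by (rule 1 2; use P in auto)+
    then show "\<bar>rs_sum (\<lambda>x. f x - h x) g P - (I - J)\<bar> < \<epsilon>"
      unfolding rs_sum_diff by linarith
  qed (use d1 d2 in auto)
qed

lemma has_rs_integral_abs_le:
  assumes "has_rs_integral f g a b I" "\<And>P. P tagged_division_of {a..b} \<Longrightarrow> \<bar>rs_sum f g P\<bar> \<le> C"
  shows "\<bar>I\<bar> \<le> C"
proof (rule field_le_epsilon)
  fix \<epsilon> :: real assume "0 < \<epsilon>"
  then obtain \<delta> where "0 < \<delta>" and
    \<delta>: "\<And>P. P tagged_division_of {a..b} \<Longrightarrow> \<forall>(u, K)\<in>P. Sup K - Inf K < \<delta> \<Longrightarrow> \<bar>rs_sum f g P - I\<bar> < \<epsilon>"
    using has_rs_integralE[OF assms(1)] by blast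
  obtain P where P: "P tagged_division_of {a..b}" "\<forall>(u, K)\<in>P. Sup K - Inf K < \<delta>"
    using tagged_division_small_mesh[OF \<open>0 < \<delta>\<close>] by blast
  show "\<bar>I\<bar> \<le> C + \<epsilon>" using \<delta>[OF P] assms(2)[OF P(1)] by linarith
qed

text \<open>The difference is an integral of the integrand \<open>f - f\<close>, all of whose sums
  vanish, so the bound \<open>0\<close> applies to it.\<close>

lemma has_rs_integral_unique:
  assumes "has_rs_integral f g a b I" "has_rs_integral f g a b J"
  shows "I = J"
  using has_rs_integral_abs_le[OF has_rs_integral_diff[OF assms], of 0] by (simp add: rs_sum_def)

lemma rs_integral_eqI: "has_rs_integral f g a b I \<Longrightarrow> rs_integral f g a b = I"
  unfolding rs_integral_def by (rule the_equality) (auto intro: has_rs_integral_unique)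

text \<open>Tags and cell endpoints all lie in \<open>{a..b}\<close>, so the sums see no other
  values.\<close>

lemma has_rs_integral_cong:
  assumes "\<And>x. a \<le> x \<Longrightarrow> x \<le> b \<Longrightarrow> f x = f' x" "\<And>x. a \<le> x \<Longrightarrow> x \<le> b \<Longrightarrow> g x = g' x"
  shows "has_rs_integral f g a b I \<longleftrightarrow> has_rs_integral f' g' a b I"
proof -
  have *: "rs_sum f g P = rs_sum f' g' P" if P: "P tagged_division_of {a..b}" for P
    unfolding rs_sum_def
  proof (intro sum.cong refl, clarify)
    fix u K assume "(u, K) \<in> P"
    from tagged_division_of_real_cell[OF P this] obtain s t where
      "a \<le> s" "s \<le> u" "u \<le> t" "t \<le> b" "Inf K = s" "Sup K = t" by metis
    then show "f u * (g (Sup K) - g (Inf K)) = f' u * (g' (Sup K) - g' (Inf K))"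
      using assms by simp
  qed
  then show ?thesis unfolding has_rs_integral_rs_sum by (simp add: * cong: conj_cong)
qed

text \<open>Both sides are definite descriptions of the same predicate, so the equation holds
  whether or not the integral exists.\<close>

lemma rs_integral_cong:
  assumes "\<And>x. a \<le> x \<Longrightarrow> x \<le> b \<Longrightarrow> f x = f' x" "\<And>x. a \<le> x \<Longrightarrow> x \<le> b \<Longrightarrow> g x = g' x"
  shows "rs_integral f g a b = rs_integral f' g' a b"
proof -
  have "has_rs_integral f g a b = has_rs_integral f' g' a b"
    by (rule ext, rule has_rs_integral_cong) (use assms in auto)
  then show ?thesis by (simp add: rs_integral_def)
qed

section \<open>Estimates by the variation of the integrator, and integration by parts\<close>

lemma variation_le_nonneg:
  assumes "variation_le g a b M"
  shows "0 \<le> M"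
proof -
  obtain P where "P tagged_division_of {a..b}" by (rule tagged_division_small_mesh[of 1 a b]) auto
  then have "(\<Sum>(u, K)\<in>P. \<bar>g (Sup K) - g (Inf K)\<bar>) \<le> M"
    using assms by (auto simp: variation_le_def)
  moreover have "0 \<le> (\<Sum>(u, K)\<in>P. \<bar>g (Sup K) - g (Inf K)\<bar>)"
    by (intro sum_nonneg) auto
  ultimately show ?thesis by linarith
qed

lemma rs_sum_abs_le:
  assumes P: "P tagged_division_of {a..b}" and g: "variation_le g a b M"
    and f: "\<And>x. a \<le> x \<Longrightarrow> x \<le> b \<Longrightarrow> \<bar>f x\<bar> \<le> B" and "0 \<le> B"
  shows "\<bar>rs_sum f g P\<bar> \<le> B * M"
proof -
  have "\<bar>rs_sum f g P\<bar> \<le> (\<Sum>(u, K)\<in>P. B * \<bar>g (Sup K) - g (Inf K)\<bar>)"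
    unfolding rs_sum_def
  proof (rule order_trans[OF sum_abs], intro sum_mono, clarify)
    fix u K assume "(u, K) \<in> P"
    from tagged_division_of_real_cell[OF P this] obtain s t where
      "a \<le> s" "s \<le> u" "u \<le> t" "t \<le> b" by metis
    then have "\<bar>f u\<bar> \<le> B" using f by simp
    then show "\<bar>f u * (g (Sup K) - g (Inf K))\<bar> \<le> B * \<bar>g (Sup K) - g (Inf K)\<bar>"
      by (simp add: abs_mult mult_right_mono)
  qed
  also have "\<dots> = B * (\<Sum>(u, K)\<in>P. \<bar>g (Sup K) - g (Inf K)\<bar>)"
    by (simp add: sum_distrib_left case_prod_unfold)
  also have "\<dots> \<le> B * M"
    using g P \<open>0 \<le> B\<close> by (auto simp: variation_le_def intro: mult_left_mono)
  finally show ?thesis .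
qed

lemma has_rs_integral_bound:
  assumes "has_rs_integral f g a b I" "variation_le g a b M"
    and "\<And>x. a \<le> x \<Longrightarrow> x \<le> b \<Longrightarrow> \<bar>f x\<bar> \<le> B" "0 \<le> B"
  shows "\<bar>I\<bar> \<le> B * M"
  by (rule has_rs_integral_abs_le[OF assms(1)]) (rule rs_sum_abs_le[OF _ assms(2-4)]; assumption)

text \<open>After subtracting the value of \<open>g\<close> at the tag, the error on one cell is bounded by its
  length times the oscillation of \<open>g\<close>, and the lengths add up to \<open>b - a\<close>.\<close>

lemma has_rs_integral_by_parts:
  fixes f f' g :: "real \<Rightarrow> real"
  assumes ab: "a \<le> b" and f: "\<And>x. (f has_real_derivative f' x) (at x)"
    and f': "continuous_on UNIV f'" and g: "continuous_on {a..b} g"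
  shows "has_rs_integral f g a b (f b * g b - f a * g a - integral {a..b} (\<lambda>x. g x * f' x))"
  unfolding has_rs_integral_rs_sum
proof (intro allI impI)
  fix \<epsilon> :: real assume "0 < \<epsilon>"
  have "bounded (f' ` {a..b})"
    using f' by (intro compact_imp_bounded compact_continuous_image) (auto intro: continuous_on_subset)
  then obtain L where L: "0 < L" "\<And>x. a \<le> x \<Longrightarrow> x \<le> b \<Longrightarrow> \<bar>f' x\<bar> \<le> L"
    unfolding bounded_pos by auto
  \<comment> \<open>Each cell will contribute three errors of size \<open>L * \<eta>\<close> times
    its length; the \<open>+ 1\<close> makes the total strictly smaller than
    \<open>\<epsilon>\<close> and covers \<open>a = b\<close>.\<close>
  define \<eta> where "\<eta> = \<epsilon> / (3 * L * (b - a + 1))"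
  have \<eta>: "0 < \<eta>" using \<open>0 < \<epsilon>\<close> L ab by (simp add: \<eta>_def)
  have "uniformly_continuous_on {a..b} g"
    using g by (intro compact_uniformly_continuous) auto
  then obtain \<delta> where "0 < \<delta>" and
    "\<forall>x\<in>{a..b}. \<forall>y\<in>{a..b}. dist y x < \<delta> \<longrightarrow> dist (g y) (g x) < \<eta>"
    using \<eta> unfolding uniformly_continuous_on_def by blast
  then have \<delta>: "0 < \<delta>" "\<And>x y. x \<in> {a..b} \<Longrightarrow> y \<in> {a..b} \<Longrightarrow> \<bar>x - y\<bar> < \<delta> \<Longrightarrow> \<bar>g x - g y\<bar> < \<eta>"
    by (auto simp: dist_real_def)
  \<comment> \<open>The claimed value of the integral is \<open>\<Phi> b - \<Phi> a\<close>, which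
    telescopes over the cells; this localises the error to one cell.\<close>
  define \<Phi> where "\<Phi> = (\<lambda>x. f x * g x - integral {a..x} (\<lambda>x. g x * f' x))"
  have gf': "continuous_on {s..t} (\<lambda>x. g x * f' x)" "continuous_on {s..t} f'" if "a \<le> s" "t \<le> b" for s t
    using that g f' by (auto intro!: continuous_intros intro: continuous_on_subset)
  have gs: "continuous_on {s..t} g" if "a \<le> s" "t \<le> b" for s t
    using that g by (auto intro: continuous_on_subset)
  have cell: "\<bar>f u * (g t - g s) - (\<Phi> t - \<Phi> s)\<bar> \<le> 3 * L * \<eta> * (t - s)"
    if st: "a \<le> s" "s \<le> u" "u \<le> t" "t \<le> b" "t - s < \<delta>" for s t u
  proof -
    have osc: "\<bar>g x - g u\<bar> \<le> \<eta>" if "s \<le> x" "x \<le> t" for x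
      using \<delta>(2)[of x u] that st by fastforce
    have lip: "\<bar>f x - f y\<bar> \<le> L * (t - s)" if "s \<le> x" "x \<le> t" "s \<le> y" "y \<le> t" for x y
    proof -
      have "norm (f x - f y) \<le> L * norm (x - y)"
        by (rule field_differentiable_bound[of "{s..t}" f f'])
          (use that st L f in \<open>auto intro: has_field_derivative_at_within\<close>)
      also have "\<dots> \<le> L * (t - s)" using that L by (intro mult_left_mono) auto
      finally show ?thesis by simp
    qed
    have "((\<lambda>x. f' x) has_integral f t - f s) {s..t}"
      using st f by (intro fundamental_theorem_of_calculus)
        (auto simp: has_real_derivative_iff_has_vector_derivative[symmetric] intro: has_field_derivative_at_within)
    then have 1: "integral {s..t} f' = f t - f s" by blast
    have 2: "integral {a..s} (\<lambda>x. g x * f' x) + integral {s..t} (\<lambda>x. g x * f' x) = integral {a..t} (\<lambda>x. g x * f' x)"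
      using st gf' by (intro Henstock_Kurzweil_Integration.integral_combine integrable_continuous_real) auto
    have "integral {s..t} (\<lambda>x. g x * f' x) - g u * (f t - f s) = integral {s..t} (\<lambda>x. g x * f' x - g u * f' x)"
      using st gf'[of s t] gs[OF st(1,4)] unfolding 1[symmetric] integral_mult_right[symmetric]
      by (intro Henstock_Kurzweil_Integration.integral_diff[symmetric] integrable_continuous_real continuous_intros) auto
    moreover have "norm (integral {s..t} (\<lambda>x. g x * f' x - g u * f' x)) \<le> (\<eta> * L) * (t - s)"
    proof (rule integral_bound)
      fix x assume x: "x \<in> {s..t}"
      have "\<bar>g x - g u\<bar> * \<bar>f' x\<bar> \<le> \<eta> * L"
        using x st osc L(2)[of x] \<eta> by (intro mult_mono) auto
      then show "norm (g x * f' x - g u * f' x) \<le> \<eta> * L"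
        by (simp add: abs_mult left_diff_distrib[symmetric])
    qed (use st gf'[of s t] gs[OF st(1,4)] in \<open>auto intro!: continuous_intros\<close>)
    moreover have "\<bar>(f t - f u) * (g t - g u)\<bar> \<le> L * (t - s) * \<eta>" "\<bar>(f u - f s) * (g s - g u)\<bar> \<le> L * (t - s) * \<eta>"
      unfolding abs_mult using lip osc st L by (auto intro!: mult_mono)
    \<comment> \<open>Summation by parts with \<open>g\<close> recentred at the tag: every term on
      the right pairs a deviation of \<open>g\<close> from \<open>g u\<close>, at most
      \<open>\<eta>\<close>, with an increment of \<open>f\<close> or an integral of
      \<open>f'\<close>, at most \<open>L * (t - s)\<close>.\<close>
    moreover have "f u * (g t - g s) - (\<Phi> t - \<Phi> s) = (integral {s..t} (\<lambda>x. g x * f' x) - g u * (f t - f s))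
        - (f t - f u) * (g t - g u) - (f u - f s) * (g s - g u)"
      unfolding \<Phi>_def 2[symmetric] by (simp add: algebra_simps)
    ultimately show ?thesis by (simp add: algebra_simps abs_le_iff)
  qed
  show "\<exists>\<delta>>0. \<forall>P. P tagged_division_of {a..b} \<and> (\<forall>(u, K)\<in>P. Sup K - Inf K < \<delta>) \<longrightarrow>
     \<bar>rs_sum f g P - (f b * g b - f a * g a - integral {a..b} (\<lambda>x. g x * f' x))\<bar> < \<epsilon>"
  proof (intro exI[of _ \<delta>] conjI allI impI)
    fix P assume P: "P tagged_division_of {a..b} \<and> (\<forall>(u, K)\<in>P. Sup K - Inf K < \<delta>)"
    then have P1: "P tagged_division_of {a..b}" by simp
    have "rs_sum f g P - (\<Phi> b - \<Phi> a) = (\<Sum>(u, K)\<in>P. f u * (g (Sup K) - g (Inf K)) - (\<Phi> (Sup K) - \<Phi> (Inf K)))"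
      unfolding rs_sum_def additive_tagged_division_1[OF ab P1, of \<Phi>, symmetric]
      by (simp add: sum_subtractf case_prod_unfold)
    also have "\<bar>\<dots>\<bar> \<le> (\<Sum>(u, K)\<in>P. 3 * L * \<eta> * (Sup K - Inf K))"
    proof (rule order_trans[OF sum_abs], intro sum_mono, clarify)
      fix u K assume K: "(u, K) \<in> P"
      from tagged_division_of_real_cell[OF P1 K] obtain s t where
        "a \<le> s" "s \<le> u" "u \<le> t" "t \<le> b" "Inf K = s" "Sup K = t" by metis
      then show "\<bar>f u * (g (Sup K) - g (Inf K)) - (\<Phi> (Sup K) - \<Phi> (Inf K))\<bar> \<le> 3 * L * \<eta> * (Sup K - Inf K)"
        using cell[of s u t] P K by auto
    qed
    also have "\<dots> = 3 * L * \<eta> * (b - a)"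
      unfolding additive_tagged_division_1[OF ab P1, of "\<lambda>x. x", symmetric]
      by (simp add: sum_distrib_left case_prod_unfold)
    also have "\<dots> < 3 * L * \<eta> * (b - a + 1)"
      using L \<eta> by simp
    also have "\<dots> = \<epsilon>" using L ab by (simp add: \<eta>_def)
    finally show "\<bar>rs_sum f g P - (f b * g b - f a * g a - integral {a..b} (\<lambda>x. g x * f' x))\<bar> < \<epsilon>"
      by (simp add: \<Phi>_def)
  qed (use \<delta> in auto)
qed

section \<open>Existence, dependence on the endpoint, and stability of the integral\<close>

lemma real_polynomial_approx:
  fixes f :: "real \<Rightarrow> real"
  assumes "continuous_on {a..b} f" "0 < \<epsilon>"
  obtains p p' where "\<And>x. (p has_real_derivative p' x) (at x)" "continuous_on UNIV p'"
    "\<And>x. a \<le> x \<Longrightarrow> x \<le> b \<Longrightarrow> \<bar>f x - p x\<bar> \<le> \<epsilon>"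
proof -
  obtain p where p: "real_polynomial_function p" "\<And>x. x \<in> {a..b} \<Longrightarrow> \<bar>f x - p x\<bar> < \<epsilon>"
    using Stone_Weierstrass_real_polynomial_function[OF compact_Icc assms] by blast
  obtain p' where p': "real_polynomial_function p'" "\<And>x. (p has_real_derivative p' x) (at x)"
    using has_real_derivative_polynomial_function[OF p(1)] by blast
  have "continuous_on UNIV p'"
    using continuous_real_polymonial_function[OF p'(1)] by (simp add: continuous_at_imp_continuous_on)
  with p p' show thesis by (intro that[of p p']) (auto intro: less_imp_le)
qed

lemma rs_sum_approx:
  assumes P: "P tagged_division_of {a..b}" and g: "variation_le g a b M"
    and "\<And>x. a \<le> x \<Longrightarrow> x \<le> b \<Longrightarrow> \<bar>f x - h x\<bar> \<le> B" "0 \<le> B"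
  shows "\<bar>rs_sum f g P - rs_sum h g P\<bar> \<le> B * M"
proof -
  have "\<bar>rs_sum (\<lambda>x. f x - h x) g P\<bar> \<le> B * M"
    by (rule rs_sum_abs_le[OF P g]) (rule assms; assumption)+
  then show ?thesis by (simp only: rs_sum_diff)
qed

lemma has_rs_integral_approx:
  assumes "has_rs_integral f g a b I" "has_rs_integral h g a b J" "variation_le g a b M"
    and "\<And>x. a \<le> x \<Longrightarrow> x \<le> b \<Longrightarrow> \<bar>f x - h x\<bar> \<le> B" "0 \<le> B"
  shows "\<bar>I - J\<bar> \<le> B * M"
  by (rule has_rs_integral_bound[OF has_rs_integral_diff[OF assms(1,2)] assms(3)]) (rule assms; assumption)+

text \<open>Polynomial integrands are covered by integration by parts. For polynomials tending
  uniformly to \<open>f\<close> the variation bound makes the integrals a Cauchy sequence; since it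
  also makes the sums close uniformly over all divisions, the limit is an integral of
  \<open>f\<close>.\<close>

lemma has_rs_integral_rs_integral:
  assumes ab: "a \<le> b" and f: "continuous_on {a..b} f" and g: "continuous_on {a..b} g"
    and var: "variation_le g a b M"
  shows "has_rs_integral f g a b (rs_integral f g a b)"
proof -
  have M: "0 \<le> M" using var by (rule variation_le_nonneg)
  have "\<forall>k. \<exists>q. (\<forall>x\<in>{a..b}. \<bar>f x - fst q x\<bar> \<le> 1 / real (Suc k)) \<and> has_rs_integral (fst q) g a b (snd q)"
  proof
    fix k
    obtain p p' where "\<And>x. (p has_real_derivative p' x) (at x)" "continuous_on UNIV p'"
      and p: "\<And>x. a \<le> x \<Longrightarrow> x \<le> b \<Longrightarrow> \<bar>f x - p x\<bar> \<le> 1 / real (Suc k)"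
      by (rule real_polynomial_approx[OF f, of "1 / real (Suc k)"], simp, rule that; assumption)
    from has_rs_integral_by_parts[OF ab this(1,2) g] obtain I where "has_rs_integral p g a b I" by blast
    with p show "\<exists>q. (\<forall>x\<in>{a..b}. \<bar>f x - fst q x\<bar> \<le> 1 / real (Suc k)) \<and> has_rs_integral (fst q) g a b (snd q)"
      by (intro exI[of _ "(p, I)"]) simp
  qed
  from choice[OF this] obtain q where
    q: "\<And>k. (\<forall>x\<in>{a..b}. \<bar>f x - fst (q k) x\<bar> \<le> 1 / real (Suc k)) \<and> has_rs_integral (fst (q k)) g a b (snd (q k))"
    by blast
  define p where "p k = fst (q k)" for k
  define I where "I k = snd (q k)" for k
  have p: "\<bar>f x - p k x\<bar> \<le> 1 / real (Suc k)" if "a \<le> x" "x \<le> b" for k x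
    using q[of k] that by (simp add: p_def)
  have I: "has_rs_integral (p k) g a b (I k)" for k
    using q[of k] by (simp add: p_def I_def)
  \<comment> \<open>Both approximants are within \<open>1 / real (Suc (min k m))\<close> of
    \<open>f\<close>, hence the factor \<open>2\<close>.\<close>
  have IJ: "\<bar>I k - I m\<bar> \<le> 2 / real (Suc (min k m)) * M" for k m
  proof (rule has_rs_integral_approx[OF I I var])
    fix x assume x: "a \<le> x" "x \<le> b"
    have "1 / real (Suc k) \<le> 1 / real (Suc (min k m))" "1 / real (Suc m) \<le> 1 / real (Suc (min k m))"
      by (auto intro!: divide_left_mono)
    then show "\<bar>p k x - p m x\<bar> \<le> 2 / real (Suc (min k m))"
      using p[OF x, of k] p[OF x, of m] by linarith
  qed simp
  have inv: "\<exists>N. \<forall>k\<ge>N. C / real (Suc k) < e" if "0 < e" for e C :: real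
  proof -
    have "(\<lambda>k. C / real (Suc k)) \<longlonglongrightarrow> 0"
      by (rule LIMSEQ_Suc[OF lim_const_over_n])
    from order_tendstoD(2)[OF this that] show ?thesis by (simp add: eventually_sequentially)
  qed
  have "Cauchy I"
  proof (rule metric_CauchyI)
    fix e :: real assume "0 < e"
    then obtain N where N: "\<And>k. k \<ge> N \<Longrightarrow> 2 * M / real (Suc k) < e" using inv by blast
    show "\<exists>N. \<forall>m\<ge>N. \<forall>n\<ge>N. dist (I m) (I n) < e"
    proof (intro exI[of _ N] allI impI)
      fix m n assume "m \<ge> N" "n \<ge> N"
      then show "dist (I m) (I n) < e"
        using IJ[of m n] N[of "min m n"] by (simp add: dist_real_def)
    qed
  qed
  then obtain J where J: "I \<longlonglongrightarrow> J" using real_Cauchy_convergent convergent_def by blast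
  have "has_rs_integral f g a b J"
    unfolding has_rs_integral_rs_sum
  proof (intro allI impI)
    fix \<epsilon> :: real assume "0 < \<epsilon>"
    then have e3: "0 < \<epsilon>/3" by simp
    obtain N1 where N1: "\<And>k. k \<ge> N1 \<Longrightarrow> M / real (Suc k) < \<epsilon>/3" using inv[OF e3] by blast
    obtain N2 where N2: "\<And>k. k \<ge> N2 \<Longrightarrow> \<bar>I k - J\<bar> < \<epsilon>/3"
      using J e3 unfolding lim_sequentially dist_real_def by meson
    define k where "k = max N1 N2"
    obtain \<delta> where \<delta>: "0 < \<delta>" "\<And>P. P tagged_division_of {a..b} \<Longrightarrow> \<forall>(u, K)\<in>P. Sup K - Inf K < \<delta> \<Longrightarrow> \<bar>rs_sum (p k) g P - I k\<bar> < \<epsilon>/3"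
      using has_rs_integralE[OF I[of k] e3] by blast
    show "\<exists>\<delta>>0. \<forall>P. P tagged_division_of {a..b} \<and> (\<forall>(u, K)\<in>P. Sup K - Inf K < \<delta>) \<longrightarrow> \<bar>rs_sum f g P - J\<bar> < \<epsilon>"
    proof (intro exI[of _ \<delta>] conjI allI impI)
      fix P assume P: "P tagged_division_of {a..b} \<and> (\<forall>(u, K)\<in>P. Sup K - Inf K < \<delta>)"
      have "\<bar>rs_sum f g P - rs_sum (p k) g P\<bar> \<le> 1 / real (Suc k) * M"
        using P p by (intro rs_sum_approx[OF _ var]) auto
      moreover have "1 / real (Suc k) * M < \<epsilon>/3" using N1[of k] by (simp add: k_def)
      moreover have "\<bar>I k - J\<bar> < \<epsilon>/3" using N2[of k] by (simp add: k_def)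
      moreover have "\<bar>rs_sum (p k) g P - I k\<bar> < \<epsilon>/3" using \<delta>(2) P by blast
      ultimately show "\<bar>rs_sum f g P - J\<bar> < \<epsilon>" by linarith
    qed (rule \<delta>)
  qed
  then show ?thesis using rs_integral_eqI by metis
qed

text \<open>The single cell \<open>{c..b}\<close>, tagged at \<open>b\<close>, completes a division
  of \<open>{a..c}\<close> and contributes a nonnegative term.\<close>

lemma variation_le_subinterval:
  assumes g: "variation_le g a b M" and c: "a \<le> c" "c \<le> b"
  shows "variation_le g a c M"
  unfolding variation_le_def
proof (intro allI impI)
  fix P assume P: "P tagged_division_of {a..c}"
  have Q: "{(b, {c..b})} tagged_division_of {c..b}"
    using c by (intro tagged_division_of_self_real) auto
  have "(P \<union> {(b, {c..b})}) tagged_division_of ({a..c} \<union> {c..b})"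
    by (rule tagged_division_Un[OF P Q]) (auto simp: interior_atLeastAtMost_real)
  then have PQ: "(P \<union> {(b, {c..b})}) tagged_division_of {a..b}"
    using c by (simp add: ivl_disj_un_two_touch)
  have "(\<Sum>(u, K)\<in>P. \<bar>g (Sup K) - g (Inf K)\<bar>) \<le> (\<Sum>(u, K)\<in>P \<union> {(b, {c..b})}. \<bar>g (Sup K) - g (Inf K)\<bar>)"
    using tagged_division_ofD(1)[OF PQ] by (intro sum_mono2) auto
  also have "\<dots> \<le> M" using g PQ unfolding variation_le_def by blast
  finally show "(\<Sum>(u, K)\<in>P. \<bar>g (Sup K) - g (Inf K)\<bar>) \<le> M" .
qed

text \<open>Links the two notions of variation: \<open>variation\<close> sums over sets of cells,
  \<open>variation_le\<close> over pairs of a tag and a cell.\<close>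

lemma variation_le_bounded_linear:
  fixes \<gamma> :: "real \<Rightarrow> 'a::real_normed_vector" and \<psi> :: "'a \<Rightarrow> real"
  assumes \<psi>: "bounded_linear \<psi>" and var: "variation \<gamma> a b \<le> ennreal M" and M: "0 \<le> M"
  shows "variation_le (\<lambda>t. \<psi> (\<gamma> t)) a b (onorm \<psi> * M)"
  unfolding variation_le_def
proof (intro allI impI)
  fix P assume P: "P tagged_division_of {a..b}"
  \<comment> \<open>The case \<open>K = {}\<close> is separated because the reindexing below asks
    \<open>d\<close> to vanish on every interval without interior, and \<open>Sup {}\<close> is
    unspecified.\<close>
  define d where "d K = (if K = {} then 0 else norm (\<gamma> (Sup K) - \<gamma> (Inf K)))" for K :: "real set"
  have "(\<Sum>(u, K)\<in>P. \<bar>\<psi> (\<gamma> (Sup K)) - \<psi> (\<gamma> (Inf K))\<bar>) \<le> (\<Sum>(u, K)\<in>P. onorm \<psi> * d K)"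
  proof (intro sum_mono, clarify)
    fix u K assume "(u, K) \<in> P"
    then have "K \<noteq> {}" using tagged_division_ofD(2)[OF P] by blast
    then show "\<bar>\<psi> (\<gamma> (Sup K)) - \<psi> (\<gamma> (Inf K))\<bar> \<le> onorm \<psi> * d K"
      using onorm[OF \<psi>, of "\<gamma> (Sup K) - \<gamma> (Inf K)"]
      by (simp add: d_def linear_diff[OF bounded_linear.linear[OF \<psi>]])
  qed
  also have "\<dots> = onorm \<psi> * (\<Sum>(u, K)\<in>P. d K)"
    by (simp add: sum_distrib_left case_prod_unfold)
  \<comment> \<open>Two tags can share a cell only if the cell is degenerate, and there
    \<open>d\<close> is \<open>0\<close>; so forgetting the tags does not change the sum.\<close>
  also have "(\<Sum>(u, K)\<in>P. d K) = sum d (snd ` P)"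
    by (rule sum.over_tagged_division_lemma[OF P]) (auto simp: d_def)
  also have "sum d (snd ` P) \<le> M"
  proof -
    have D: "snd ` P division_of {a..b}" using P by (rule division_of_tagged_division)
    have "ennreal (sum d (snd ` P)) = (\<Sum>K\<in>snd ` P. ennreal (d K))"
      by (simp add: sum_ennreal d_def)
    also have "\<dots> = (\<Sum>K\<in>snd ` P. ennreal (norm (\<gamma> (Sup K) - \<gamma> (Inf K))))"
      using division_ofD(3)[OF D] by (intro sum.cong refl) (auto simp: d_def)
    also have "\<dots> \<le> variation \<gamma> a b"
      unfolding variation_def using D by (intro SUP_upper) auto
    also note var
    finally show ?thesis using M by (simp add: ennreal_le_iff)
  qed
  finally show "(\<Sum>(u, K)\<in>P. \<bar>\<psi> (\<gamma> (Sup K)) - \<psi> (\<gamma> (Inf K))\<bar>) \<le> onorm \<psi> * M"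
    using onorm_pos_le[OF \<psi>] by (simp add: mult_left_mono)
qed

lemma has_rs_integral_rs_integral_initial:
  assumes u: "a \<le> u" "u \<le> b" and f: "continuous_on {a..b} f" and g: "continuous_on {a..b} g"
    and var: "variation_le g a b M"
  shows "has_rs_integral f g a u (rs_integral f g a u)"
proof (rule has_rs_integral_rs_integral[OF u(1) _ _ variation_le_subinterval[OF var u]])
  show "continuous_on {a..u} f" "continuous_on {a..u} g"
    using f g u by (auto intro: continuous_on_subset)
qed

text \<open>Uniform approximation of the integrand by differentiable functions, for which the integral is
  explicit, transfers properties of the explicit formula to general integrands.\<close>

lemma rs_integral_approx_by_parts:
  fixes p p' :: "real \<Rightarrow> real"
  assumes u: "a \<le> u" "u \<le> b" and f: "continuous_on {a..b} f" and g: "continuous_on {a..b} g"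
    and var: "variation_le g a b M"
    and p: "\<And>x. (p has_real_derivative p' x) (at x)" and p': "continuous_on UNIV p'"
    and fp: "\<And>x. a \<le> x \<Longrightarrow> x \<le> b \<Longrightarrow> \<bar>f x - p x\<bar> \<le> B" and B: "0 \<le> B"
  shows "\<bar>rs_integral f g a u - (p u * g u - p a * g a - integral {a..u} (\<lambda>x. g x * p' x))\<bar> \<le> B * M"
proof (rule has_rs_integral_approx[OF has_rs_integral_rs_integral_initial[OF u f g var] _ variation_le_subinterval[OF var u] _ B])
  have "continuous_on {a..u} g" using g u by (auto intro: continuous_on_subset)
  then show "has_rs_integral p g a u (p u * g u - p a * g a - integral {a..u} (\<lambda>x. g x * p' x))"
    by (rule has_rs_integral_by_parts[OF u(1) p p'])
  fix x assume "a \<le> x" "x \<le> u"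
  then show "\<bar>f x - p x\<bar> \<le> B" using u fp by simp
qed

text \<open>The by-parts expression \<open>F\<close> is continuous in the upper endpoint and
  approximates the integral with an error uniform in that endpoint. The result allows an indefinite
  integral to serve as the next integrand.\<close>

lemma continuous_on_rs_integral:
  assumes f: "continuous_on {a..b} f" and g: "continuous_on {a..b} g"
    and var: "variation_le g a b M"
  shows "continuous_on {a..b} (\<lambda>u. rs_integral f g a u)"
  unfolding continuous_on_iff
proof (intro ballI allI impI)
  fix x \<epsilon> :: real assume x: "x \<in> {a..b}" and \<epsilon>: "0 < \<epsilon>"
  have M: "0 \<le> M" using var by (rule variation_le_nonneg)
  define \<eta> where "\<eta> = \<epsilon> / (3 * (M + 1))"
  have \<eta>: "0 < \<eta>" using \<epsilon> M by (simp add: \<eta>_def)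
  have \<eta>M: "\<eta> * M \<le> \<epsilon>/3" using \<epsilon> M by (simp add: \<eta>_def field_simps)
  obtain p p' where p: "\<And>x. (p has_real_derivative p' x) (at x)" "continuous_on UNIV p'"
    "\<And>x. a \<le> x \<Longrightarrow> x \<le> b \<Longrightarrow> \<bar>f x - p x\<bar> \<le> \<eta>"
    by (rule real_polynomial_approx[OF f \<eta>], rule that; assumption)
  define F where "F u = p u * g u - p a * g a - integral {a..u} (\<lambda>x. g x * p' x)" for u
  have "continuous_on {a..b} p" using p(1) by (intro DERIV_continuous_on) (auto intro: has_field_derivative_at_within)
  moreover have "continuous_on {a..b} p'" using p(2) by (auto intro: continuous_on_subset)
  ultimately have "continuous_on {a..b} F"
    unfolding F_def using g
    by (intro continuous_intros indefinite_integral_continuous_1 integrable_continuous_real) auto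
  then obtain \<delta> where \<delta>: "0 < \<delta>" "\<And>y. y \<in> {a..b} \<Longrightarrow> dist y x < \<delta> \<Longrightarrow> dist (F y) (F x) < \<epsilon>/3"
    using x \<epsilon> unfolding continuous_on_iff by (metis divide_pos_pos zero_less_numeral)
  have FR: "\<bar>rs_integral f g a u - F u\<bar> \<le> \<epsilon>/3" if "u \<in> {a..b}" for u
    using rs_integral_approx_by_parts[of a u b f g M p p' \<eta>] that f g var p \<eta> \<eta>M by (simp add: F_def)
  show "\<exists>d>0. \<forall>y\<in>{a..b}. dist y x < d \<longrightarrow> dist (rs_integral f g a y) (rs_integral f g a x) < \<epsilon>"
  proof (intro exI[of _ \<delta>] conjI ballI impI)
    fix y assume "y \<in> {a..b}" "dist y x < \<delta>"
    then show "dist (rs_integral f g a y) (rs_integral f g a x) < \<epsilon>"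
      using \<delta>(2)[of y] FR[of y] FR[OF x] unfolding dist_real_def by linarith
  qed (rule \<delta>)
qed

text \<open>A polynomial \<open>p\<close> near the limit integrand \<open>f\<close> is eventually
  near every \<open>fs j\<close> too. With \<open>p\<close> fixed, the by-parts functional
  \<open>F\<close> depends on the integrator in a Lipschitz way for the uniform norm, whereas
  replacing an integrand by \<open>p\<close> costs only a multiple of the common bound
  \<open>M\<close>.\<close>

lemma uniform_limit_rs_integral:
  fixes fs gs :: "'i \<Rightarrow> real \<Rightarrow> real"
  assumes ab: "a \<le> b" and f: "continuous_on {a..b} f" and g: "continuous_on {a..b} g" "variation_le g a b M"
    and fs: "\<And>j. continuous_on {a..b} (fs j)"
    and gs: "\<And>j. continuous_on {a..b} (gs j)" "\<And>j. variation_le (gs j) a b M"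
    and lim: "uniform_limit {a..b} fs f \<F>" "uniform_limit {a..b} gs g \<F>"
  shows "uniform_limit {a..b} (\<lambda>j u. rs_integral (fs j) (gs j) a u) (\<lambda>u. rs_integral f g a u) \<F>"
proof (rule uniform_limitI)
  fix \<epsilon> :: real assume \<epsilon>: "0 < \<epsilon>"
  have M: "0 \<le> M" using g(2) by (rule variation_le_nonneg)
  \<comment> \<open>Replacing the integrands by \<open>p\<close> costs \<open>2 * \<eta> * M\<close>
    for \<open>fs j\<close> and \<open>\<eta> * M\<close> for \<open>f\<close>; the \<open>6\<close>
    brings the sum of the two below half of \<open>\<epsilon>\<close>.\<close>
  define \<eta> where "\<eta> = \<epsilon> / (6 * (M + 1))"
  have \<eta>: "0 < \<eta>" using \<epsilon> M by (simp add: \<eta>_def)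
  have \<eta>M: "3 * (\<eta> * M) < \<epsilon>/2" using \<epsilon> M by (simp add: \<eta>_def field_simps)
  obtain p p' where p: "\<And>x. (p has_real_derivative p' x) (at x)" "continuous_on UNIV p'"
    "\<And>x. a \<le> x \<Longrightarrow> x \<le> b \<Longrightarrow> \<bar>f x - p x\<bar> \<le> \<eta>"
    by (rule real_polynomial_approx[OF f \<eta>], rule that; assumption)
  have cp: "continuous_on {a..b} p" using p(1) by (intro DERIV_continuous_on) (auto intro: has_field_derivative_at_within)
  have cp': "continuous_on {a..b} p'" using p(2) by (auto intro: continuous_on_subset)
  have "bounded (p ` {a..b})" "bounded (p' ` {a..b})"
    using cp cp' by (auto intro: compact_imp_bounded compact_continuous_image)
  then obtain L L' where L: "0 < L" "\<And>x. x \<in> {a..b} \<Longrightarrow> \<bar>p x\<bar> \<le> L"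
    and L': "0 < L'" "\<And>x. x \<in> {a..b} \<Longrightarrow> \<bar>p' x\<bar> \<le> L'"
    unfolding bounded_pos by auto
  \<comment> \<open>Lipschitz constant of \<open>F\<close> in the integrator: two boundary terms
    with \<open>\<bar>p\<bar> \<le> L\<close> and the integral with
    \<open>\<bar>p'\<bar> \<le> L'\<close>.\<close>
  define C where "C = 2 * L + L' * (b - a)"
  have C: "0 < C" using L L' ab by (simp add: C_def add_pos_nonneg)
  define \<kappa> where "\<kappa> = \<epsilon> / (2 * C)"
  have \<kappa>: "0 < \<kappa>" "\<kappa> * C = \<epsilon>/2" using \<epsilon> C by (simp_all add: \<kappa>_def)
  define F where "F h u = p u * h u - p a * h a - integral {a..u} (\<lambda>x. h x * p' x)" for h u
  have diff: "\<bar>F h u - F g u\<bar> \<le> \<kappa> * C"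
    if h: "continuous_on {a..b} h" "\<And>x. x \<in> {a..b} \<Longrightarrow> \<bar>h x - g x\<bar> \<le> \<kappa>" and u: "u \<in> {a..b}" for h u
  proof -
    have c: "continuous_on {a..u} h" "continuous_on {a..u} g" "continuous_on {a..u} p'"
      using u h g cp' by (auto intro: continuous_on_subset)
    have "norm (integral {a..u} (\<lambda>x. h x * p' x - g x * p' x)) \<le> (\<kappa> * L') * (u - a)"
    proof (rule integral_bound)
      fix x assume x: "x \<in> {a..u}"
      have "\<bar>h x - g x\<bar> * \<bar>p' x\<bar> \<le> \<kappa> * L'"
        using x u h L' \<kappa> by (intro mult_mono) auto
      then show "norm (h x * p' x - g x * p' x) \<le> \<kappa> * L'"
        by (simp add: abs_mult left_diff_distrib[symmetric])
    qed (use u c in \<open>auto intro!: continuous_intros\<close>)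
    also have "\<dots> \<le> \<kappa> * L' * (b - a)"
      using \<kappa> L' u by (intro mult_left_mono) auto
    finally have 1: "\<bar>integral {a..u} (\<lambda>x. h x * p' x) - integral {a..u} (\<lambda>x. g x * p' x)\<bar> \<le> \<kappa> * L' * (b - a)"
      using c by (subst Henstock_Kurzweil_Integration.integral_diff[symmetric])
        (auto intro!: integrable_continuous_real continuous_intros)
    have 2: "\<bar>p x * (h x - g x)\<bar> \<le> L * \<kappa>" if "x \<in> {a..b}" for x
      unfolding abs_mult using that h L by (intro mult_mono) auto
    have "F h u - F g u = p u * (h u - g u) - p a * (h a - g a)
       - (integral {a..u} (\<lambda>x. h x * p' x) - integral {a..u} (\<lambda>x. g x * p' x))"
      by (simp add: F_def algebra_simps)
    moreover have "\<kappa> * C = L * \<kappa> + L * \<kappa> + \<kappa> * L' * (b - a)"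
      by (simp add: C_def algebra_simps)
    ultimately show ?thesis using 1 2[OF u] 2[of a] ab by simp
  qed
  have 1: "\<forall>\<^sub>F j in \<F>. \<forall>x\<in>{a..b}. dist (fs j x) (f x) < \<eta>" using uniform_limitD[OF lim(1) \<eta>] .
  have 2: "\<forall>\<^sub>F j in \<F>. \<forall>x\<in>{a..b}. dist (gs j x) (g x) < \<kappa>" using uniform_limitD[OF lim(2) \<kappa>(1)] .
  show "\<forall>\<^sub>F j in \<F>. \<forall>u\<in>{a..b}. dist (rs_integral (fs j) (gs j) a u) (rs_integral f g a u) < \<epsilon>"
    using 1 2
  proof eventually_elim
    case (elim j)
    show ?case
    proof
      fix u assume u: "u \<in> {a..b}"
      \<comment> \<open>One \<open>\<eta>\<close> is spent between \<open>fs j\<close> and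
        \<open>f\<close>, the other between \<open>f\<close> and \<open>p\<close>.\<close>
      have "\<bar>rs_integral (fs j) (gs j) a u - F (gs j) u\<bar> \<le> 2 * \<eta> * M"
        unfolding F_def
      proof (rule rs_integral_approx_by_parts[OF _ _ fs gs p(1,2)])
        fix x assume x: "a \<le> x" "x \<le> b"
        then show "\<bar>fs j x - p x\<bar> \<le> 2 * \<eta>"
          using p(3)[OF x] elim(1)[THEN bspec, of x] unfolding dist_real_def by simp
      qed (use u \<eta> in auto)
      moreover have "\<bar>rs_integral f g a u - F g u\<bar> \<le> \<eta> * M"
        unfolding F_def by (rule rs_integral_approx_by_parts[OF _ _ f g p]) (use u \<eta> in auto)
      moreover have "\<bar>F (gs j) u - F g u\<bar> \<le> \<kappa> * C"
        by (rule diff[OF gs(1) _ u]) (use elim(2) in \<open>auto simp: dist_real_def intro: less_imp_le\<close>)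
      ultimately show "dist (rs_integral (fs j) (gs j) a u) (rs_integral f g a u) < \<epsilon>"
        using \<eta>M \<kappa>(2) unfolding dist_real_def by linarith
    qed
  qed
qed

section \<open>Change of variable under a dilation of the parameter\<close>

lemma tagged_division_of_dilated:
  fixes c u :: real
  assumes c: "0 < c" and P: "P tagged_division_of {0..u}"
  shows "(\<lambda>(x, K). (c * x, (*) c ` K)) ` P tagged_division_of {0..c * u}"
proof (rule tagged_division_ofI)
  note PD = tagged_division_ofD[OF P]
  have img: "(*) c ` {s..t} = {c * s..c * t}" for s t
    using c by (simp add: image_mult_atLeastAtMost)
  show "finite ((\<lambda>(x, K). (c * x, (*) c ` K)) ` P)" using PD(1) by simp
  fix x K assume "(x, K) \<in> (\<lambda>(x, K). (c * x, (*) c ` K)) ` P"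
  then obtain y L where L: "(y, L) \<in> P" and xK: "x = c * y" "K = (*) c ` L" by auto
  obtain s t where st: "L = {s..t}" "0 \<le> s" "s \<le> y" "y \<le> t" "t \<le> u"
    using tagged_division_of_real_cell[OF P L] by metis
  show "x \<in> K" using xK PD(2)[OF L] by auto
  show "K \<subseteq> {0..c * u}" using xK st c by (auto simp: img intro: mult_left_mono order_trans)
  show "\<exists>a b. K = cbox a b" using xK st by (auto simp: img)
next
  have int: "interior ((*) c ` K) = (*) c ` interior K" for K :: "real set"
    using c by (intro interior_injective_linear_image) (auto simp: inj_on_def)
  fix x1 K1 x2 K2
  assume 1: "(x1, K1) \<in> (\<lambda>(x, K). (c * x, (*) c ` K)) ` P"
    and 2: "(x2, K2) \<in> (\<lambda>(x, K). (c * x, (*) c ` K)) ` P" and ne: "(x1, K1) \<noteq> (x2, K2)"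
  obtain y1 L1 where L1: "(y1, L1) \<in> P" "x1 = c * y1" "K1 = (*) c ` L1" using 1 by auto
  obtain y2 L2 where L2: "(y2, L2) \<in> P" "x2 = c * y2" "K2 = (*) c ` L2" using 2 by auto
  have "(y1, L1) \<noteq> (y2, L2)" using ne L1 L2 by auto
  then have "interior L1 \<inter> interior L2 = {}" using tagged_division_ofD(5)[OF P L1(1) L2(1)] by blast
  then show "interior K1 \<inter> interior K2 = {}" unfolding L1(3) L2(3) int using c by auto
next
  have "\<Union>{K. \<exists>x. (x, K) \<in> (\<lambda>(x, K). (c * x, (*) c ` K)) ` P} = (*) c ` \<Union>{K. \<exists>x. (x, K) \<in> P}"
    by force
  also have "\<dots> = {0..c * u}"
    unfolding tagged_division_ofD(6)[OF P] using c by (simp add: image_mult_atLeastAtMost)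
  finally show "\<Union>{K. \<exists>x. (x, K) \<in> (\<lambda>(x, K). (c * x, (*) c ` K)) ` P} = {0..c * u}" .
qed

text \<open>Dilation carries divisions of \<open>{0..u}\<close> to divisions of
  \<open>{0..c * u}\<close>, multiplies the mesh by \<open>c\<close> and matches the sums up to the
  factor \<open>r * s\<close>; the shift \<open>t\<close> cancels in increments. It is present
  because rescaling a path also subtracts its initial value.\<close>

lemma has_rs_integral_dilated:
  assumes c: "0 < c" and I: "has_rs_integral f g 0 (c * u) I"
  shows "has_rs_integral (\<lambda>x. r * f (c * x)) (\<lambda>x. s * g (c * x) + t) 0 u (r * s * I)"
  unfolding has_rs_integral_rs_sum
proof (intro allI impI)
  fix \<epsilon> :: real assume "0 < \<epsilon>"
  \<comment> \<open>The \<open>+ 1\<close> covers \<open>r * s = 0\<close>.\<close>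
  then have e: "0 < \<epsilon> / (\<bar>r * s\<bar> + 1)" by simp
  obtain \<delta> where \<delta>: "0 < \<delta>" "\<And>P. P tagged_division_of {0..c * u} \<Longrightarrow>
      \<forall>(u, K)\<in>P. Sup K - Inf K < \<delta> \<Longrightarrow> \<bar>rs_sum f g P - I\<bar> < \<epsilon> / (\<bar>r * s\<bar> + 1)"
    using has_rs_integralE[OF I e] by blast
  show "\<exists>\<delta>>0. \<forall>P. P tagged_division_of {0..u} \<and> (\<forall>(u, K)\<in>P. Sup K - Inf K < \<delta>) \<longrightarrow>
    \<bar>rs_sum (\<lambda>x. r * f (c * x)) (\<lambda>x. s * g (c * x) + t) P - r * s * I\<bar> < \<epsilon>"
  proof (intro exI[of _ "\<delta> / c"] conjI allI impI)
    fix P assume P: "P tagged_division_of {0..u} \<and> (\<forall>(u, K)\<in>P. Sup K - Inf K < \<delta> / c)"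
    let ?m = "\<lambda>(x, K). (c * x, (*) c ` K)"
    have cell: "Sup ((*) c ` K) = c * Sup K \<and> Inf ((*) c ` K) = c * Inf K" if "(x, K) \<in> P" for x K
    proof -
      obtain s t where st: "K = {s..t}" "0 \<le> s" "s \<le> x" "x \<le> t" "t \<le> u" "Inf K = s" "Sup K = t"
        using tagged_division_of_real_cell[OF conjunct1[OF P] \<open>(x, K) \<in> P\<close>] by metis
      then have "c * s \<le> c * t" using c by simp
      with st c show ?thesis by (simp add: image_mult_atLeastAtMost)
    qed
    have inj: "inj_on ?m P" using c by (auto simp: inj_on_def inj_image_eq_iff)
    have "rs_sum (\<lambda>x. r * f (c * x)) (\<lambda>x. s * g (c * x) + t) P = r * s * rs_sum f g (?m ` P)"
      unfolding rs_sum_def sum.reindex[OF inj] sum_distrib_left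
    proof (intro sum.cong refl, clarify)
      fix x K assume "(x, K) \<in> P"
      then have "Sup ((*) c ` K) = c * Sup K" "Inf ((*) c ` K) = c * Inf K" using cell by auto
      then show "r * f (c * x) * (s * g (c * Sup K) + t - (s * g (c * Inf K) + t)) =
          r * s * ((\<lambda>(u, K). f u * (g (Sup K) - g (Inf K))) \<circ> ?m) (x, K)"
        by (simp only: o_def case_prod_conv) (simp add: algebra_simps)
    qed
    moreover have "\<bar>rs_sum f g (?m ` P) - I\<bar> < \<epsilon> / (\<bar>r * s\<bar> + 1)"
    proof (rule \<delta>(2))
      show "?m ` P tagged_division_of {0..c * u}"
        using tagged_division_of_dilated[OF c conjunct1[OF P]] .
      show "\<forall>(u, K)\<in>?m ` P. Sup K - Inf K < \<delta>"
      proof clarify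
        fix x K assume K: "(x, K) \<in> P"
        then have "Sup K - Inf K < \<delta> / c" using P by auto
        then show "Sup ((*) c ` K) - Inf ((*) c ` K) < \<delta>"
          using cell[OF K] c by (simp add: field_simps)
      qed
    qed
    then have "(\<bar>r * s\<bar> + 1) * \<bar>rs_sum f g (?m ` P) - I\<bar> < \<epsilon>"
      by (simp add: field_simps add_pos_nonneg)
    moreover have "\<bar>r * s * rs_sum f g (?m ` P) - r * s * I\<bar> = \<bar>r * s\<bar> * \<bar>rs_sum f g (?m ` P) - I\<bar>"
      unfolding right_diff_distrib[symmetric] by (simp only: abs_mult)
    ultimately show "\<bar>rs_sum (\<lambda>x. r * f (c * x)) (\<lambda>x. s * g (c * x) + t) P - r * s * I\<bar> < \<epsilon>"
      by (simp add: distrib_right)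
  qed (use \<delta> c in auto)
qed

section \<open>Iterated integrals\<close>

text \<open>Functionals are applied only to values and increments of the path, which stay in
  \<open>W\<close>. This permits replacing coordinates that are linear on \<open>W\<close> alone by
  functionals that are linear everywhere.\<close>

lemma iter_integral_cong:
  assumes "subspace W" "list_all2 (\<lambda>\<phi> \<psi>. \<forall>v\<in>W. \<phi> v = \<psi> v) \<phi>s \<psi>s" "s \<le> t" "\<gamma> ` {s..t} \<subseteq> W"
  shows "iter_integral \<gamma> s t \<phi>s = iter_integral \<gamma> s t \<psi>s"
  using assms(2-4)
proof (induction \<gamma> s t \<phi>s arbitrary: \<psi>s rule: iter_integral.induct)
  case (1 \<gamma> s t)
  then show ?case by simp
next
  case (2 \<gamma> s t \<phi>)
  then have "\<gamma> t - \<gamma> s \<in> W" using assms(1) by (intro subspace_diff) auto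
  with 2 show ?case by (auto simp: list_all2_Cons1)
next
  case (3 \<gamma> s t \<phi> \<psi> \<phi>s)
  obtain \<phi>' \<psi>' \<phi>s' where \<psi>s: "\<psi>s = \<phi>' # \<psi>' # \<phi>s'" and eq: "\<And>v. v \<in> W \<Longrightarrow> \<phi> v = \<phi>' v"
    and rest: "list_all2 (\<lambda>\<phi> \<psi>. \<forall>v\<in>W. \<phi> v = \<psi> v) (\<psi> # \<phi>s) (\<psi>' # \<phi>s')"
    using 3(2) by (auto simp: list_all2_Cons1)
  show ?case unfolding \<psi>s iter_integral.simps
  proof (rule rs_integral_cong)
    fix u assume u: "s \<le> u" "u \<le> t"
    show "iter_integral \<gamma> s u (\<psi> # \<phi>s) = iter_integral \<gamma> s u (\<psi>' # \<phi>s')"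
      using 3(4) u by (intro 3(1)[OF rest]) auto
    show "\<phi> (\<gamma> u) = \<phi>' (\<gamma> u)" using 3(4) u by (intro eq) auto
  qed
qed

text \<open>The induction follows the three equations of \<open>iter_integral\<close>. The inner
  integral enters through its continuity only; the variation bound is that of the outer
  integrator.\<close>

lemma continuous_on_iter_integral:
  assumes \<gamma>: "continuous_on {a..b} \<gamma>" and var: "variation \<gamma> a b \<le> ennreal M" "0 \<le> M"
    and "\<And>\<phi>. \<phi> \<in> set \<phi>s \<Longrightarrow> bounded_linear \<phi>"
  shows "continuous_on {a..b} (\<lambda>u. iter_integral \<gamma> a u \<phi>s)"
  using assms(4)
proof (induction \<phi>s rule: induct_list012)
  case (2 \<phi>)
  then have "bounded_linear \<phi>" by simp
  then show ?case unfolding iter_integral.simps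
    by (rule bounded_linear.continuous_on) (intro continuous_intros \<gamma>)
next
  case (3 \<phi> \<psi> \<phi>s)
  then have \<phi>: "bounded_linear \<phi>" by simp
  show ?case unfolding iter_integral.simps
  proof (rule continuous_on_rs_integral)
    show "continuous_on {a..b} (\<lambda>u. iter_integral \<gamma> a u (\<psi> # \<phi>s))" using 3 by simp
    show "continuous_on {a..b} (\<lambda>u. \<phi> (\<gamma> u))" by (rule bounded_linear.continuous_on[OF \<phi> \<gamma>])
    show "variation_le (\<lambda>u. \<phi> (\<gamma> u)) a b (onorm \<phi> * M)"
      by (rule variation_le_bounded_linear[OF \<phi> var])
  qed
qed simp

text \<open>By induction the inner integrals converge uniformly; they are integrated against
  coordinates that converge uniformly and share the variation bound
  \<open>onorm \<phi> * M\<close>.\<close>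

lemma uniform_limit_iter_integral:
  fixes \<gamma>s :: "'i \<Rightarrow> real \<Rightarrow> 'a::real_normed_vector"
  assumes ab: "a \<le> b" and \<gamma>: "continuous_on {a..b} \<gamma>" "variation \<gamma> a b \<le> ennreal M"
    and \<gamma>s: "\<And>j. continuous_on {a..b} (\<gamma>s j)" "\<And>j. variation (\<gamma>s j) a b \<le> ennreal M"
    and M: "0 \<le> M" and lim: "uniform_limit {a..b} \<gamma>s \<gamma> \<F>"
    and "\<And>\<phi>. \<phi> \<in> set \<phi>s \<Longrightarrow> bounded_linear \<phi>"
  shows "uniform_limit {a..b} (\<lambda>j u. iter_integral (\<gamma>s j) a u \<phi>s) (\<lambda>u. iter_integral \<gamma> a u \<phi>s) \<F>"
  using assms(8)
proof (induction \<phi>s rule: induct_list012)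
  case 1
  then show ?case by (simp add: uniform_limit_const)
next
  case (2 \<phi>)
  then have \<phi>: "bounded_linear \<phi>" by simp
  have "uniform_limit {a..b} (\<lambda>j _. \<gamma>s j a) (\<lambda>_. \<gamma> a) \<F>"
    using lim ab by (auto simp: uniform_limit_iff elim!: eventually_mono)
  with lim have "uniform_limit {a..b} (\<lambda>j u. \<gamma>s j u - \<gamma>s j a) (\<lambda>u. \<gamma> u - \<gamma> a) \<F>"
    by (rule uniform_limit_minus)
  from bounded_linear.uniform_limit[OF \<phi> this] show ?case by simp
next
  case (3 \<phi> \<psi> \<phi>s)
  then have \<phi>: "bounded_linear \<phi>" and rest: "\<And>\<phi>. \<phi> \<in> set (\<psi> # \<phi>s) \<Longrightarrow> bounded_linear \<phi>" by auto
  show ?case unfolding iter_integral.simps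
  proof (rule uniform_limit_rs_integral[OF ab])
    show "continuous_on {a..b} (\<lambda>u. iter_integral \<gamma> a u (\<psi> # \<phi>s))"
      by (rule continuous_on_iter_integral[OF \<gamma> M rest])
    show "continuous_on {a..b} (\<lambda>u. iter_integral (\<gamma>s j) a u (\<psi> # \<phi>s))" for j
      by (rule continuous_on_iter_integral[OF \<gamma>s M rest])
    show "uniform_limit {a..b} (\<lambda>j u. iter_integral (\<gamma>s j) a u (\<psi> # \<phi>s)) (\<lambda>u. iter_integral \<gamma> a u (\<psi> # \<phi>s)) \<F>"
      by (rule 3(2)[OF rest])
    show "uniform_limit {a..b} (\<lambda>j u. \<phi> (\<gamma>s j u)) (\<lambda>u. \<phi> (\<gamma> u)) \<F>"
      by (rule bounded_linear.uniform_limit[OF \<phi> lim])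
  qed (rule bounded_linear.continuous_on[OF \<phi>] variation_le_bounded_linear[OF \<phi> _ M] \<gamma> \<gamma>s)+
qed

text \<open>Each of the \<open>length \<phi>s\<close> increments contributes one factor
  \<open>1 / c\<close>, and the change of parameter contributes none.\<close>

lemma iter_integral_rescaled:
  fixes \<gamma> :: "real \<Rightarrow> 'a::real_normed_vector"
  assumes c: "0 < c" and "continuous_on {0..c * u} \<gamma>" "bounded_var \<gamma> 0 (c * u)" "0 \<le> u"
    and lin: "\<And>\<phi>. \<phi> \<in> set \<phi>s \<Longrightarrow> bounded_linear \<phi>"
  shows "iter_integral (rescaled \<gamma> c) 0 u \<phi>s = (1 / c) ^ length \<phi>s * iter_integral \<gamma> 0 (c * u) \<phi>s"
proof -
  define M where "M = enn2real (variation \<gamma> 0 (c * u))"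
  have M: "0 \<le> M" by (simp add: M_def)
  have var: "variation \<gamma> 0 (c * u) \<le> ennreal M"
    using assms(3) by (simp add: M_def bounded_var_def less_top)
  \<comment> \<open>The endpoint is quantified inside the induction because the inner integral is
    needed at every \<open>v\<close> up to \<open>x\<close>.\<close>
  have "\<forall>x\<in>{0..u}. iter_integral (rescaled \<gamma> c) 0 x \<phi>s = (1 / c) ^ length \<phi>s * iter_integral \<gamma> 0 (c * x) \<phi>s"
    using lin
  proof (induction \<phi>s rule: induct_list012)
    case (2 \<phi>)
    then interpret bounded_linear \<phi> by simp
    show ?case by (simp add: rescaled_def scaleR diff divide_inverse)
  next
    case (3 \<phi> \<psi> \<phi>s)
    then have \<phi>: "bounded_linear \<phi>" and rest: "\<And>\<phi>. \<phi> \<in> set (\<psi> # \<phi>s) \<Longrightarrow> bounded_linear \<phi>" by auto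
    interpret bounded_linear \<phi> by (rule \<phi>)
    show ?case
    proof
      fix x assume x: "x \<in> {0..u}"
      let ?n = "length (\<psi> # \<phi>s)"
      have cx: "0 \<le> c * x" "c * x \<le> c * u" using c x by (auto intro: mult_left_mono)
      have "has_rs_integral (\<lambda>v. iter_integral \<gamma> 0 v (\<psi> # \<phi>s)) (\<lambda>v. \<phi> (\<gamma> v)) 0 (c * x)
              (iter_integral \<gamma> 0 (c * x) (\<phi> # \<psi> # \<phi>s))"
        unfolding iter_integral.simps
      proof (rule has_rs_integral_rs_integral_initial[OF cx])
        show "continuous_on {0..c * u} (\<lambda>v. iter_integral \<gamma> 0 v (\<psi> # \<phi>s))"
          by (rule continuous_on_iter_integral[OF assms(2) var M rest])
        show "continuous_on {0..c * u} (\<lambda>v. \<phi> (\<gamma> v))"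
          by (rule bounded_linear.continuous_on[OF \<phi> assms(2)])
        show "variation_le (\<lambda>v. \<phi> (\<gamma> v)) 0 (c * u) (onorm \<phi> * M)"
          by (rule variation_le_bounded_linear[OF \<phi> var M])
      qed
      \<comment> \<open>The first factor is the scaling of the inner integral from the induction;
        the other two turn \<open>\<phi> (\<gamma> (c * v))\<close> into
        \<open>\<phi> (rescaled \<gamma> c v)\<close>.\<close>
      from has_rs_integral_dilated[OF c this, of "(1 / c) ^ ?n" "1 / c" "- \<phi> (\<gamma> 0) / c"]
      have "has_rs_integral (\<lambda>v. iter_integral (rescaled \<gamma> c) 0 v (\<psi> # \<phi>s)) (\<lambda>v. \<phi> (rescaled \<gamma> c v)) 0 x
         ((1 / c) ^ ?n * (1 / c) * iter_integral \<gamma> 0 (c * x) (\<phi> # \<psi> # \<phi>s))"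
      proof (rule has_rs_integral_cong[THEN iffD1, rotated -1])
        fix v assume v: "0 \<le> v" "v \<le> x"
        show "(1 / c) ^ ?n * iter_integral \<gamma> 0 (c * v) (\<psi> # \<phi>s) = iter_integral (rescaled \<gamma> c) 0 v (\<psi> # \<phi>s)"
          using 3(2)[OF rest] v x by simp
        show "1 / c * \<phi> (\<gamma> (c * v)) + - \<phi> (\<gamma> 0) / c = \<phi> (rescaled \<gamma> c v)"
          using c by (simp add: rescaled_def scaleR diff field_simps)
      qed
      from rs_integral_eqI[OF this]
      show "iter_integral (rescaled \<gamma> c) 0 x (\<phi> # \<psi> # \<phi>s)
          = (1 / c) ^ length (\<phi> # \<psi> # \<phi>s) * iter_integral \<gamma> 0 (c * x) (\<phi> # \<psi> # \<phi>s)"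
        by simp
    qed
  qed simp
  then show ?thesis using assms(4) by simp
qed

section \<open>Linear maps on finite-dimensional normed spaces\<close>

text \<open>The box is a Minkowski sum of compact segments, one for each vector of \<open>S\<close>,
  so no equivalence of norms enters.\<close>

lemma compact_coordinate_box:
  fixes S :: "'a::real_normed_vector set"
  assumes "finite S"
  shows "compact {\<Sum>b\<in>S. c b *\<^sub>R b |c. \<forall>b\<in>S. \<bar>c b\<bar> \<le> (1::real)}"
  using assms
proof (induction S)
  case empty
  then show ?case by simp
next
  case (insert a S)
  have "{\<Sum>b\<in>insert a S. c b *\<^sub>R b |c. \<forall>b\<in>insert a S. \<bar>c b\<bar> \<le> (1::real)} =
    {x + y |x y. x \<in> (\<lambda>r. r *\<^sub>R a) ` {-1..1} \<and> y \<in> {\<Sum>b\<in>S. c b *\<^sub>R b |c. \<forall>b\<in>S. \<bar>c b\<bar> \<le> 1}}" (is "?L = ?R")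
  proof
    show "?L \<subseteq> ?R"
    proof clarify
      fix c :: "'a \<Rightarrow> real" assume c: "\<forall>b\<in>insert a S. \<bar>c b\<bar> \<le> 1"
      then have "c a \<in> {-1..1}" by auto
      with c insert show "\<exists>x y. (\<Sum>b\<in>insert a S. c b *\<^sub>R b) = x + y \<and> x \<in> (\<lambda>r. r *\<^sub>R a) ` {-1..1} \<and>
          y \<in> {\<Sum>b\<in>S. c b *\<^sub>R b |c. \<forall>b\<in>S. \<bar>c b\<bar> \<le> 1}"
        by (intro exI[of _ "c a *\<^sub>R a"] exI[of _ "\<Sum>b\<in>S. c b *\<^sub>R b"]) auto
    qed
    show "?R \<subseteq> ?L"
    proof clarify
      fix r :: real and c :: "'a \<Rightarrow> real" assume c: "r \<in> {-1..1}" "\<forall>b\<in>S. \<bar>c b\<bar> \<le> 1"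
      have "(\<Sum>b\<in>insert a S. (c(a := r)) b *\<^sub>R b) = r *\<^sub>R a + (\<Sum>b\<in>S. (c(a := r)) b *\<^sub>R b)"
        using insert by simp
      also have "(\<Sum>b\<in>S. (c(a := r)) b *\<^sub>R b) = (\<Sum>b\<in>S. c b *\<^sub>R b)"
        using insert by (intro sum.cong) auto
      finally show "\<exists>c'. r *\<^sub>R a + (\<Sum>b\<in>S. c b *\<^sub>R b) = (\<Sum>b\<in>insert a S. c' b *\<^sub>R b) \<and> (\<forall>b\<in>insert a S. \<bar>c' b\<bar> \<le> 1)"
        using c by (intro exI[of _ "c(a := r)"]) auto
    qed
  qed
  also have "compact \<dots>"
    using insert by (intro compact_sums compact_continuous_image continuous_intros) auto
  finally show ?case .
qed

text \<open>Normalise a vector so that its largest coordinate is \<open>1\<close>: the vectors obtained form a compact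
  set which misses \<open>0\<close> by independence.\<close>

lemma independent_coordinates_bounded:
  fixes B :: "'a::real_normed_vector set"
  assumes B: "finite B" "independent B"
  obtains C where "0 < C" "\<And>c b. b \<in> B \<Longrightarrow> \<bar>c b\<bar> \<le> C * norm (\<Sum>b\<in>B. c b *\<^sub>R b)"
proof -
  \<comment> \<open>The vectors with coordinate \<open>1\<close> at \<open>b\<close> and all others
    in \<open>[-1, 1]\<close>.\<close>
  define D where "D b = (+) b ` {\<Sum>b'\<in>B - {b}. c b' *\<^sub>R b' |c. \<forall>b'\<in>B - {b}. \<bar>c b'\<bar> \<le> (1::real)}" for b
  have "\<exists>\<delta>>0. \<forall>x\<in>D b. \<delta> \<le> norm x" if b: "b \<in> B" for b
  proof -
    have "closed (D b)"
      unfolding D_def using B(1)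
      by (intro compact_imp_closed compact_translation compact_coordinate_box) auto
    moreover have "0 \<notin> D b"
    proof
      assume "0 \<in> D b"
      then obtain c where "0 = b + (\<Sum>b'\<in>B - {b}. c b' *\<^sub>R b')" by (auto simp: D_def)
      then have "b = - (\<Sum>b'\<in>B - {b}. c b' *\<^sub>R b')" by (simp add: eq_neg_iff_add_eq_0)
      also have "\<dots> \<in> span (B - {b})"
        by (intro span_neg span_sum span_scale span_base)
      finally show False using B(2) b by (auto simp: dependent_def)
    qed
    ultimately obtain \<delta> where "0 < \<delta>" "ball 0 \<delta> \<subseteq> - D b"
      using open_contains_ball[of "- D b"] by (auto simp: open_Compl)
    then show ?thesis by (intro exI[of _ \<delta>]) (auto simp: subset_iff not_less[symmetric])
  qed
  then have "\<forall>b. \<exists>\<delta>. b \<in> B \<longrightarrow> 0 < \<delta> \<and> (\<forall>x\<in>D b. \<delta> \<le> norm x)" by blast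
  from choice[OF this] obtain \<delta> where \<delta>: "\<And>b. b \<in> B \<Longrightarrow> 0 < \<delta> b" "\<And>b x. b \<in> B \<Longrightarrow> x \<in> D b \<Longrightarrow> \<delta> b \<le> norm x"
    by blast
  \<comment> \<open>The entry \<open>1\<close> gives the minimum a meaning when \<open>B\<close> is
    empty.\<close>
  define m where "m = Min (insert 1 (\<delta> ` B))"
  have m: "0 < m" "\<And>b. b \<in> B \<Longrightarrow> m \<le> \<delta> b" using B(1) \<delta>(1) by (auto simp: m_def)
  show thesis
  proof (rule that)
    show "0 < 1 / m" using m by simp
    fix c :: "'a \<Rightarrow> real" and b assume b: "b \<in> B"
    let ?x = "\<Sum>b\<in>B. c b *\<^sub>R b"
    \<comment> \<open>Dividing by the coordinate of largest modulus moves the vector into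
      \<open>D b0\<close>.\<close>
    obtain b0 where b0: "b0 \<in> B" "\<And>b'. b' \<in> B \<Longrightarrow> \<bar>c b'\<bar> \<le> \<bar>c b0\<bar>"
    proof -
      have "Max ((\<lambda>b. \<bar>c b\<bar>) ` B) \<in> (\<lambda>b. \<bar>c b\<bar>) ` B" using B(1) b by (intro Max_in) auto
      then obtain b0 where "b0 \<in> B" "Max ((\<lambda>b. \<bar>c b\<bar>) ` B) = \<bar>c b0\<bar>" by auto
      moreover have "\<bar>c b'\<bar> \<le> Max ((\<lambda>b. \<bar>c b\<bar>) ` B)" if "b' \<in> B" for b'
        using that B(1) by (intro Max_ge) auto
      ultimately show thesis by (intro that[of b0]) auto
    qed
    show "\<bar>c b\<bar> \<le> 1 / m * norm ?x"
    proof (cases "c b0 = 0")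
      case True
      then show ?thesis using b0(2)[OF b] m by simp
    next
      case False
      have "?x = c b0 *\<^sub>R b0 + (\<Sum>b\<in>B - {b0}. c b *\<^sub>R b)"
        using B(1) b0(1) by (simp add: sum.remove)
      then have "(1 / c b0) *\<^sub>R ?x = b0 + (\<Sum>b\<in>B - {b0}. (c b / c b0) *\<^sub>R b)"
        using False by (simp add: scaleR_add_right scaleR_sum_right)
      also have "\<dots> \<in> D b0"
        unfolding D_def using False b0 by (intro imageI CollectI exI[of _ "\<lambda>b. c b / c b0"]) auto
      finally have "m \<le> norm ((1 / c b0) *\<^sub>R ?x)"
        using \<delta>(2)[OF b0(1)] m(2)[OF b0(1)] by (meson order_trans)
      then have "m * \<bar>c b0\<bar> \<le> norm ?x" using False by (simp add: field_simps)
      then have "\<bar>c b0\<bar> \<le> norm ?x / m" using m(1) by (simp add: field_simps)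
      then show ?thesis using b0(2)[OF b] by simp
    qed
  qed
qed

lemma finite_dim_linear_imp_bounded_linear:
  fixes f :: "'a::real_normed_vector \<Rightarrow> 'b::real_normed_vector"
  assumes fin: "\<exists>B::'a set. finite B \<and> span B = UNIV" and f: "linear f"
  shows "bounded_linear f"
proof -
  define E where "E = some_basis (UNIV :: 'a set)"
  have E: "independent E" "span E = UNIV"
    unfolding E_def using some_basis[of UNIV] by auto
  have finE: "finite E" using fin independent_span_bound[OF _ E(1)] by auto
  obtain C where C: "0 < C" "\<And>c b. b \<in> E \<Longrightarrow> \<bar>c b\<bar> \<le> C * norm (\<Sum>b\<in>E. c b *\<^sub>R b)"
    using independent_coordinates_bounded[OF finE E(1)] by blast
  show ?thesis
  proof (rule bounded_linear_intro[of _ "C * (\<Sum>b\<in>E. norm (f b))"])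
    fix x
    have x: "(\<Sum>b\<in>E. representation E x b *\<^sub>R b) = x"
      using E finE by (intro sum_representation_eq) auto
    have "f x = (\<Sum>b\<in>E. representation E x b *\<^sub>R f b)"
      using linear_sum[OF f, of "\<lambda>b. representation E x b *\<^sub>R b" E]
      unfolding x linear_scale[OF f] .
    also have "norm \<dots> \<le> (\<Sum>b\<in>E. C * norm x * norm (f b))"
      using C(2)[of _ "representation E x"] unfolding x
      by (intro order_trans[OF norm_sum] sum_mono) (auto intro!: mult_right_mono)
    finally show "norm (f x) \<le> norm x * (C * (\<Sum>b\<in>E. norm (f b)))"
      by (simp add: sum_distrib_left mult_ac)
  qed (use f in \<open>auto simp: linear_add linear_scale\<close>)
qed

text \<open>Expanding only the first argument in a basis leaves finitely many linear maps
  \<open>br b\<close>, each bounded by its operator norm.\<close>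

lemma finite_dim_bilinear_imp_bounded_bilinear:
  fixes br :: "'a::real_normed_vector \<Rightarrow> 'a \<Rightarrow> 'b::real_normed_vector"
  assumes fin: "\<exists>B::'a set. finite B \<and> span B = UNIV" and br: "bilinear br"
  shows "bounded_bilinear br"
proof -
  have lin: "linear (br x)" "linear (\<lambda>x. br x y)" for x y using br by (auto simp: bilinear_def)
  define E where "E = some_basis (UNIV :: 'a set)"
  have E: "independent E" "span E = UNIV"
    unfolding E_def using some_basis[of UNIV] by auto
  have finE: "finite E" using fin independent_span_bound[OF _ E(1)] by auto
  obtain C where C: "0 < C" "\<And>c b. b \<in> E \<Longrightarrow> \<bar>c b\<bar> \<le> C * norm (\<Sum>b\<in>E. c b *\<^sub>R b)"
    using independent_coordinates_bounded[OF finE E(1)] by blast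
  show ?thesis
  proof
    show "\<exists>K. \<forall>x y. norm (br x y) \<le> norm x * norm y * K"
    proof (intro exI allI)
      fix x y
      have x: "(\<Sum>b\<in>E. representation E x b *\<^sub>R b) = x"
        using E finE by (intro sum_representation_eq) auto
      have "br x y = (\<Sum>b\<in>E. representation E x b *\<^sub>R br b y)"
        using linear_sum[OF lin(2), of "\<lambda>b. representation E x b *\<^sub>R b" E y]
        unfolding x bilinear_lmul[OF br] .
      also have "norm \<dots> \<le> (\<Sum>b\<in>E. (C * norm x) * (onorm (br b) * norm y))"
      proof (intro order_trans[OF norm_sum] sum_mono)
        fix b assume "b \<in> E"
        then have "\<bar>representation E x b\<bar> \<le> C * norm x" using C(2)[of b "representation E x"] x by simp
        moreover have "norm (br b y) \<le> onorm (br b) * norm y"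
          by (intro onorm finite_dim_linear_imp_bounded_linear[OF fin] lin)
        ultimately show "norm (representation E x b *\<^sub>R br b y) \<le> (C * norm x) * (onorm (br b) * norm y)"
          using C(1) by (auto intro!: mult_mono)
      qed
      also have "\<dots> = norm x * norm y * (C * (\<Sum>b\<in>E. onorm (br b)))"
        by (simp add: sum_distrib_left mult_ac)
      finally show "norm (br x y) \<le> norm x * norm y * (C * (\<Sum>b\<in>E. onorm (br b)))" .
    qed
  qed (simp_all add: bilinear_ladd[OF br] bilinear_radd[OF br] bilinear_lmul[OF br] bilinear_rmul[OF br])
qed

lemma finite_some_basis:
  fixes W :: "'a::real_vector set"
  assumes fin: "\<exists>B::'a set. finite B \<and> span B = UNIV" and W: "subspace W"
  shows "finite (some_basis W)"
  using fin independent_span_bound[OF _ some_basis(1)[OF W]] by auto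

text \<open>\<open>representation\<close> is \<open>0\<close> outside the span of the basis, so in
  general it is not linear on the whole space. The dual basis of \<open>W\<close> is therefore
  extended to linear functionals, which finite dimension makes bounded.\<close>

lemma representation_extends:
  fixes W :: "'a::real_normed_vector set"
  assumes fin: "\<exists>B::'a set. finite B \<and> span B = UNIV" and W: "subspace W"
  obtains \<psi> :: "'a \<Rightarrow> 'a \<Rightarrow> real" where "\<And>e. bounded_linear (\<psi> e)"
    "\<And>e v. e \<in> some_basis W \<Longrightarrow> v \<in> W \<Longrightarrow> representation (some_basis W) v e = \<psi> e v"
proof -
  let ?E = "some_basis W"
  note E = some_basis[OF W] finite_some_basis[OF fin W]
  have "\<forall>e. \<exists>g. linear g \<and> (\<forall>x\<in>?E. g x = (if x = e then 1 else 0 :: real))"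
  proof
    fix e
    show "\<exists>g. linear g \<and> (\<forall>x\<in>?E. g x = (if x = e then 1 else 0 :: real))"
      using linear_independent_extend[OF E(1), of "\<lambda>x. if x = e then 1 else 0 :: real"] .
  qed
  from choice[OF this] obtain \<psi> :: "'a \<Rightarrow> 'a \<Rightarrow> real" where
    \<psi>: "\<And>e. linear (\<psi> e)" "\<And>e x. x \<in> ?E \<Longrightarrow> \<psi> e x = (if x = e then 1 else 0)" by blast
  show thesis
  proof (rule that)
    show "bounded_linear (\<psi> e)" for e
      by (rule finite_dim_linear_imp_bounded_linear[OF fin \<psi>(1)])
    fix e v assume e: "e \<in> ?E" and v: "v \<in> W"
    have "v = (\<Sum>b\<in>?E. representation ?E v b *\<^sub>R b)"
      using E v by (intro sum_representation_eq[symmetric]) auto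
    then have "\<psi> e v = \<psi> e (\<Sum>b\<in>?E. representation ?E v b *\<^sub>R b)" by simp
    also have "\<dots> = (\<Sum>b\<in>?E. if b = e then representation ?E v b else 0)"
      unfolding linear_sum[OF \<psi>(1)] linear_scale[OF \<psi>(1)] by (intro sum.cong refl) (simp add: \<psi>(2))
    also have "\<dots> = representation ?E v e"
      using e E(3) by simp
    finally show "representation ?E v e = \<psi> e v" ..
  qed
qed

text \<open>Puts \<open>lie_T\<close> in the form to which the results on iterated integrals along
  bounded functionals apply: a combination of fixed brackets with such integrals as
  coefficients.\<close>

lemma lie_T_bounded_linear_coordinates:
  fixes W :: "'a::real_normed_vector set"
  assumes fin: "\<exists>B::'a set. finite B \<and> span B = UNIV" and W: "subspace W"
  obtains \<psi> :: "'a \<Rightarrow> 'a \<Rightarrow> real" where "\<And>e. bounded_linear (\<psi> e)"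
    "\<And>br (\<gamma> :: real \<Rightarrow> 'a) a t i. a \<le> t \<Longrightarrow> \<gamma> ` {a..t} \<subseteq> W \<Longrightarrow> lie_T br W \<gamma> a t i =
       (\<Sum>w | set w \<subseteq> some_basis W \<and> length w = Suc i. iter_integral \<gamma> a t (map \<psi> w) *\<^sub>R left_bracket br w)"
proof -
  obtain \<psi> :: "'a \<Rightarrow> 'a \<Rightarrow> real" where \<psi>: "\<And>e. bounded_linear (\<psi> e)"
    "\<And>e v. e \<in> some_basis W \<Longrightarrow> v \<in> W \<Longrightarrow> representation (some_basis W) v e = \<psi> e v"
    using representation_extends[OF fin W] by blast
  show thesis
  proof (rule that[OF \<psi>(1)])
    fix br :: "'a \<Rightarrow> 'a \<Rightarrow> 'a" and \<gamma> :: "real \<Rightarrow> 'a" and a t i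
    assume \<gamma>: "a \<le> t" "\<gamma> ` {a..t} \<subseteq> W"
    show "lie_T br W \<gamma> a t i =
       (\<Sum>w | set w \<subseteq> some_basis W \<and> length w = Suc i. iter_integral \<gamma> a t (map \<psi> w) *\<^sub>R left_bracket br w)"
      unfolding lie_T_def tensor_bracket_def
    proof (intro sum.cong refl arg_cong2[where f = scaleR])
      fix w assume w: "w \<in> {w. set w \<subseteq> some_basis W \<and> length w = Suc i}"
      show "iter_integral \<gamma> a t (map (\<lambda>e v. representation (some_basis W) v e) w) = iter_integral \<gamma> a t (map \<psi> w)"
      proof (rule iter_integral_cong[OF W _ \<gamma>])
        show "list_all2 (\<lambda>\<phi> \<psi>. \<forall>v\<in>W. \<phi> v = \<psi> v) (map (\<lambda>e v. representation (some_basis W) v e) w) (map \<psi> w)"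
          using w \<psi>(2) by (auto simp: list_all2_conv_all_nth subset_iff)
      qed
    qed
  qed
qed

section \<open>Homogeneity and stability of the Lie integral\<close>

text \<open>Give \<open>T j\<close> weight \<open>Suc j\<close> and \<open>lie_rec br T i\<close>
  weight \<open>i\<close>. In the equation for \<open>Suc m\<close>, every nested bracket has weight
  \<open>sum_list ms + Suc (m - r) = Suc m\<close>, because \<open>ms\<close> sums to
  \<open>r\<close>; the bracket with coefficient \<open>1 / 2\<close> has the same weight.\<close>

lemma lie_rec_scaled:
  fixes br :: "'a::real_vector \<Rightarrow> 'a \<Rightarrow> 'a"
  assumes br: "bilinear br" and T: "\<And>j. T' j = c ^ Suc j *\<^sub>R T j"
  shows "lie_rec br T' k = c ^ k *\<^sub>R lie_rec br T k"
proof (induction k rule: less_induct)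
  case (less k)
  show ?case
  proof (cases k)
    case 0
    then show ?thesis by simp
  next
    case (Suc m)
    have IH: "lie_rec br T' i = c ^ i *\<^sub>R lie_rec br T i" if "i \<le> m" for i
      using less Suc that by simp
    \<comment> \<open>The exponent \<open>q\<close> is the weight of the innermost entry; below it
      is \<open>Suc (m - r)\<close>.\<close>
    have fold: "foldr (\<lambda>i y. br (lie_rec br T' i) y) ms (c ^ q *\<^sub>R y)
        = c ^ (sum_list ms + q) *\<^sub>R foldr (\<lambda>i y. br (lie_rec br T i) y) ms y"
      if "\<forall>i\<in>set ms. i \<le> m" for ms q y
      using that
      by (induction ms) (simp_all add: IH bilinear_lmul[OF br] bilinear_rmul[OF br] power_add)
    have sums: "(\<Sum>ms | length ms = 2 * p \<and> (\<forall>i\<in>set ms. 0 < i) \<and> sum_list ms = r.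
                foldr (\<lambda>i y. br (lie_rec br T' i) y) ms (T' (m - r)))
        = c ^ Suc m *\<^sub>R (\<Sum>ms | length ms = 2 * p \<and> (\<forall>i\<in>set ms. 0 < i) \<and> sum_list ms = r.
                foldr (\<lambda>i y. br (lie_rec br T i) y) ms (T (m - r)))" if r: "r \<le> m" for p r
      unfolding scaleR_sum_right
    proof (intro sum.cong refl)
      fix ms assume ms: "ms \<in> {ms. length ms = 2 * p \<and> (\<forall>i\<in>set ms. 0 < i) \<and> sum_list ms = r}"
      then have "\<forall>i\<in>set ms. i \<le> m" using r by (auto dest: member_le_sum_list)
      from fold[OF this, of "Suc (m - r)" "T (m - r)"]
      show "foldr (\<lambda>i y. br (lie_rec br T' i) y) ms (T' (m - r))
          = c ^ Suc m *\<^sub>R foldr (\<lambda>i y. br (lie_rec br T i) y) ms (T (m - r))"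
        using ms r by (simp only: T) simp
    qed
    have half: "br (lie_rec br T' r) (T' (m - r)) = c ^ Suc m *\<^sub>R br (lie_rec br T r) (T (m - r))"
      if r: "r \<le> m" for r
    proof -
      have "r + Suc (m - r) = Suc m" using r by simp
      then have "c ^ r * c ^ Suc (m - r) = c ^ Suc m" "c ^ Suc (m - r) * c ^ r = c ^ Suc m"
        by (metis power_add, metis power_add add.commute)
      then show ?thesis
        by (simp only: IH[OF r] T bilinear_lmul[OF br] bilinear_rmul[OF br] scaleR_scaleR)
    qed
    \<comment> \<open>Stated for an abstract \<open>C\<close>, so that \<open>c ^ Suc m\<close>
      moves out as a whole and is not unfolded into a product.\<close>
    have pull: "(1 / 2) *\<^sub>R (C *\<^sub>R x) + (\<Sum>p\<in>A. \<beta> p *\<^sub>R (C *\<^sub>R y p)) = C *\<^sub>R ((1 / 2) *\<^sub>R x + (\<Sum>p\<in>A. \<beta> p *\<^sub>R y p))"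
      for C :: real and x :: 'a and A :: "nat set" and \<beta> y
      by (simp add: scaleR_add_right scaleR_sum_right mult.commute)
    have "(\<Sum>r=1..m. (1 / 2) *\<^sub>R br (lie_rec br T' r) (T' (m - r))
        + (\<Sum>p | 1 \<le> p \<and> 2 * p \<le> r. (bernoulli (2 * p) / fact (2 * p)) *\<^sub>R
          (\<Sum>ms | length ms = 2 * p \<and> (\<forall>i\<in>set ms. 0 < i) \<and> sum_list ms = r.
             foldr (\<lambda>i y. br (lie_rec br T' i) y) ms (T' (m - r)))))
      = c ^ Suc m *\<^sub>R (\<Sum>r=1..m. (1 / 2) *\<^sub>R br (lie_rec br T r) (T (m - r))
        + (\<Sum>p | 1 \<le> p \<and> 2 * p \<le> r. (bernoulli (2 * p) / fact (2 * p)) *\<^sub>R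
          (\<Sum>ms | length ms = 2 * p \<and> (\<forall>i\<in>set ms. 0 < i) \<and> sum_list ms = r.
             foldr (\<lambda>i y. br (lie_rec br T i) y) ms (T (m - r)))))"
      unfolding scaleR_sum_right[of "c ^ Suc m" _ "{1..m}"]
    proof (rule sum.cong[OF refl], goal_cases)
      case (1 r)
      then have r: "r \<le> m" by simp
      show ?case unfolding half[OF r] sums[OF r] by (rule pull)
    qed
    then show ?thesis
      unfolding Suc lie_rec.simps T[of m] scaleR_add_right[symmetric]
      by (simp only: scaleR_add_right scaleR_scaleR mult.commute)
  qed
qed

text \<open>The last letter of the word is bracketed outermost and raises the layer by one; hence
  the induction from the right.\<close>

lemma (in graded_lie_algebra) left_bracket_in_layer:
  assumes "set w \<subseteq> V 1" "w \<noteq> []"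
  shows "left_bracket br w \<in> V (length w)"
  using assms(2,1)
proof (induction w rule: rev_nonempty_induct)
  case (single v)
  then show ?case by simp
next
  case (snoc v us)
  then have "left_bracket br (us @ [v]) = br (left_bracket br us) v"
    by (cases us) auto
  then show ?case
    using snoc bracket_layer[of "length us" 1 "left_bracket br us" v] by (cases us) auto
qed

lemma (in graded_lie_algebra) lie_T_in_layer: "lie_T br (V 1) \<gamma> a b i \<in> V (Suc i)"
  unfolding lie_T_def tensor_bracket_def
proof (intro subspace_sum subspace_scale subspace_layer)
  fix w assume w: "w \<in> {w. set w \<subseteq> some_basis (V 1) \<and> length w = Suc i}"
  have "some_basis (V 1) \<subseteq> V 1"
    using some_basis(2)[OF subspace_layer[of 1]] span_superset by auto
  then have "left_bracket br w \<in> V (length w)"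
    using w by (intro left_bracket_in_layer) auto
  then show "left_bracket br w \<in> V (Suc i)" using w by simp
qed auto

text \<open>The weight count of \<open>lie_rec_scaled\<close>, with weights read as layers of the
  grading.\<close>

lemma (in graded_lie_algebra) lie_rec_in_layer:
  assumes T: "\<And>j. T j \<in> V (Suc j)"
  shows "1 \<le> k \<Longrightarrow> lie_rec br T k \<in> V k"
proof (induction k rule: less_induct)
  case (less k)
  then obtain m where k: "k = Suc m" by (cases k) auto
  have IH: "lie_rec br T i \<in> V i" if "0 < i" "i \<le> m" for i
    using less k that by simp
  have fold: "foldr (\<lambda>i y. br (lie_rec br T i) y) ms y \<in> V (sum_list ms + q)"
    if "\<forall>i\<in>set ms. 0 < i \<and> i \<le> m" "y \<in> V q" "1 \<le> q" for ms q y
    using that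
  proof (induction ms)
    case (Cons i ms)
    then have "br (lie_rec br T i) (foldr (\<lambda>i y. br (lie_rec br T i) y) ms y) \<in> V (i + (sum_list ms + q))"
      by (intro bracket_layer IH) auto
    then show ?case by (simp add: add.assoc)
  qed simp
  have sub: "subspace (V (Suc m))" by (rule subspace_layer) simp
  show ?case unfolding k lie_rec.simps
  proof (intro subspace_scale[OF sub] subspace_add[OF sub] subspace_sum[OF sub] T)
    fix r assume r: "r \<in> {1..m}"
    have "br (lie_rec br T r) (T (m - r)) \<in> V (r + Suc (m - r))"
      using r by (intro bracket_layer IH T) auto
    then show "br (lie_rec br T r) (T (m - r)) \<in> V (Suc m)" using r by simp
    fix p ms assume "ms \<in> {ms. length ms = 2 * p \<and> (\<forall>i\<in>set ms. 0 < i) \<and> sum_list ms = r}"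
    then have ms: "\<forall>i\<in>set ms. 0 < i \<and> i \<le> m" "sum_list ms = r"
      using r by (auto dest: member_le_sum_list)
    from fold[OF ms(1) T, of "m - r"] ms(2) r
    show "foldr (\<lambda>i y. br (lie_rec br T i) y) ms (T (m - r)) \<in> V (Suc m)" by simp
  qed
qed

text \<open>Uniform convergence passes to bilinear expressions when the limits are bounded.
  Continuity of the limit on a compact set supplies this and is itself inherited, so the pair is
  stable under every operation in the recursion.\<close>

definition continuous_uniform_limit ::
    "'b::topological_space set \<Rightarrow> ('i \<Rightarrow> 'b \<Rightarrow> 'a::metric_space) \<Rightarrow> ('b \<Rightarrow> 'a) \<Rightarrow> 'i filter \<Rightarrow> bool" where
  "continuous_uniform_limit S f l \<F> \<longleftrightarrow> uniform_limit S f l \<F> \<and> continuous_on S l"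

lemma continuous_uniform_limit_const: "continuous_uniform_limit S (\<lambda>_ _. c) (\<lambda>_. c) \<F>"
  by (simp add: continuous_uniform_limit_def uniform_limit_const)

lemma continuous_uniform_limit_add:
  fixes f g :: "'i \<Rightarrow> 'b::topological_space \<Rightarrow> 'a::real_normed_vector"
  shows "continuous_uniform_limit S f l \<F> \<Longrightarrow> continuous_uniform_limit S g m \<F> \<Longrightarrow>
    continuous_uniform_limit S (\<lambda>j u. f j u + g j u) (\<lambda>u. l u + m u) \<F>"
  by (simp add: continuous_uniform_limit_def uniform_limit_add continuous_on_add)

lemma continuous_uniform_limit_sum:
  fixes f :: "'k \<Rightarrow> 'i \<Rightarrow> 'b::topological_space \<Rightarrow> 'a::real_normed_vector"
  assumes "\<And>k. k \<in> A \<Longrightarrow> continuous_uniform_limit S (f k) (l k) \<F>"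
  shows "continuous_uniform_limit S (\<lambda>j u. \<Sum>k\<in>A. f k j u) (\<lambda>u. \<Sum>k\<in>A. l k u) \<F>"
  using assms
  by (induction A rule: infinite_finite_induct)
    (simp_all add: continuous_uniform_limit_const continuous_uniform_limit_add)

lemma continuous_uniform_limit_bounded_linear:
  assumes "bounded_linear h" "continuous_uniform_limit S f l \<F>"
  shows "continuous_uniform_limit S (\<lambda>j u. h (f j u)) (\<lambda>u. h (l u)) \<F>"
  using assms(2) unfolding continuous_uniform_limit_def
  by (intro conjI bounded_linear.uniform_limit[OF assms(1)] bounded_linear.continuous_on[OF assms(1)]) auto

lemma continuous_uniform_limit_bounded_bilinear:
  assumes h: "bounded_bilinear h" and S: "compact S"
    and f: "continuous_uniform_limit S f l \<F>" and g: "continuous_uniform_limit S g m \<F>"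
  shows "continuous_uniform_limit S (\<lambda>j u. h (f j u) (g j u)) (\<lambda>u. h (l u) (m u)) \<F>"
proof -
  have c: "continuous_on S l" "continuous_on S m"
    using f g by (simp_all add: continuous_uniform_limit_def)
  then have "bounded (l ` S)" "bounded (m ` S)"
    using S by (auto intro: compact_imp_bounded compact_continuous_image)
  then show ?thesis
    using f g c unfolding continuous_uniform_limit_def
    by (intro conjI bounded_bilinear.bounded_uniform_limit[OF h] bounded_bilinear.continuous_on[OF h]) auto
qed

text \<open>\<open>lie_rec br T k\<close> is a fixed finite expression in the entries of
  \<open>T\<close>, built from sums, scalar multiples and brackets, each of which preserves such
  limits.\<close>

lemma continuous_uniform_limit_lie_rec:
  fixes br :: "'a::real_normed_vector \<Rightarrow> 'a \<Rightarrow> 'a"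
  assumes br: "bounded_bilinear br" and S: "compact S"
    and T: "\<And>i. continuous_uniform_limit S (\<lambda>j u. Ts j u i) (\<lambda>u. T u i) \<F>"
  shows "continuous_uniform_limit S (\<lambda>j u. lie_rec br (Ts j u) k) (\<lambda>u. lie_rec br (T u) k) \<F>"
proof (induction k rule: less_induct)
  case (less k)
  show ?case
  proof (cases k)
    case 0
    then show ?thesis by (simp add: continuous_uniform_limit_const)
  next
    case (Suc m)
    have fold: "continuous_uniform_limit S (\<lambda>j u. foldr (\<lambda>i y. br (lie_rec br (Ts j u) i) y) ms (Ts j u q))
        (\<lambda>u. foldr (\<lambda>i y. br (lie_rec br (T u) i) y) ms (T u q)) \<F>" if "\<forall>i\<in>set ms. i < k" for ms q
      using that
      by (induction ms) (simp_all add: T less continuous_uniform_limit_bounded_bilinear[OF br S])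
    show ?thesis unfolding Suc lie_rec.simps
    proof (intro continuous_uniform_limit_bounded_linear[OF bounded_linear_scaleR_right]
        continuous_uniform_limit_add continuous_uniform_limit_sum
        continuous_uniform_limit_bounded_bilinear[OF br S] T)
      fix r assume r: "r \<in> {1..m}"
      then show "continuous_uniform_limit S (\<lambda>j u. lie_rec br (Ts j u) r) (\<lambda>u. lie_rec br (T u) r) \<F>"
        using less Suc by simp
      fix p ms assume "ms \<in> {ms. length ms = 2 * p \<and> (\<forall>i\<in>set ms. 0 < i) \<and> sum_list ms = r}"
      then show "continuous_uniform_limit S (\<lambda>j u. foldr (\<lambda>i y. br (lie_rec br (Ts j u) i) y) ms (Ts j u (m - r)))
        (\<lambda>u. foldr (\<lambda>i y. br (lie_rec br (T u) i) y) ms (T u (m - r))) \<F>"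
        using r Suc by (intro fold) (auto dest!: member_le_sum_list)
    qed
  qed
qed

section \<open>Layers, dilations and convergence of the Lie integral\<close>

lemma (in graded_lie_algebra) layer_part_sum:
  assumes v: "\<And>i. i \<in> {1..n} \<Longrightarrow> v i \<in> V i" and k: "k \<in> {1..n}"
  shows "layer_part n V k (\<Sum>i=1..n. v i) = v k"
proof -
  \<comment> \<open>\<open>is_grading\<close> demands value \<open>0\<close> outside
    \<open>{1..n}\<close>, where nothing is known of \<open>v\<close>.\<close>
  define w where "w i = (if i \<in> {1..n} then v i else 0)" for i
  have "(\<Sum>i=1..n. v i) = (\<Sum>i=1..n. w i)" by (intro sum.cong) (auto simp: w_def)
  then have "is_grading n V (\<Sum>i=1..n. v i) w"
    using v by (auto simp: is_grading_def w_def)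
  then have "(THE w. is_grading n V (\<Sum>i=1..n. v i) w) = w"
    using direct_sum by (intro the1_equality) auto
  then show ?thesis using k by (simp add: layer_part_def w_def)
qed

lemma (in graded_lie_algebra) lie_integral_part_rescaled:
  assumes c: "0 < c" and \<gamma>: "continuous_on {0..} \<gamma>" "\<gamma> ` {0..} \<subseteq> V 1" "bounded_var \<gamma> 0 (c * u)" and u: "0 \<le> u"
  shows "lie_integral_part br V (rescaled \<gamma> c) 0 u k = (1 / c) ^ k *\<^sub>R lie_integral_part br V \<gamma> 0 (c * u) k"
  unfolding lie_integral_part_def
proof (rule lie_rec_scaled[OF bilinear])
  fix i
  obtain \<psi> :: "'a \<Rightarrow> 'a \<Rightarrow> real" where \<psi>: "\<And>e. bounded_linear (\<psi> e)"
    and T: "\<And>br (\<gamma> :: real \<Rightarrow> 'a) a t i. a \<le> t \<Longrightarrow> \<gamma> ` {a..t} \<subseteq> V 1 \<Longrightarrow> lie_T br (V 1) \<gamma> a t i =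
       (\<Sum>w | set w \<subseteq> some_basis (V 1) \<and> length w = Suc i. iter_integral \<gamma> a t (map \<psi> w) *\<^sub>R left_bracket br w)"
    using lie_T_bounded_linear_coordinates[OF finite_dim subspace_layer[of 1]] by auto
  have r: "rescaled \<gamma> c ` {0..u} \<subseteq> V 1"
    using \<gamma>(2) c by (auto simp: rescaled_def intro!: subspace_scale subspace_diff subspace_layer)
  have "iter_integral (rescaled \<gamma> c) 0 u (map \<psi> w) = (1 / c) ^ length (map \<psi> w) * iter_integral \<gamma> 0 (c * u) (map \<psi> w)" for w
    using c \<gamma> u \<psi> by (intro iter_integral_rescaled) (auto intro: continuous_on_subset)
  moreover have "\<gamma> ` {0..c * u} \<subseteq> V 1" using \<gamma>(2) by auto
  ultimately show "lie_T br (V 1) (rescaled \<gamma> c) 0 u i = (1 / c) ^ Suc i *\<^sub>R lie_T br (V 1) \<gamma> 0 (c * u) i"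
    using u c r by (subst (1 2) T) (simp_all add: scaleR_sum_right)
qed

text \<open>The part of index \<open>k\<close> lies in \<open>V k\<close>, so the dilation
  multiplies it by \<open>(1 / c) ^ k\<close>, the factor that rescaling the path produces.\<close>

lemma (in graded_lie_algebra) dilation_lie_integral:
  assumes c: "0 < c" and \<gamma>: "continuous_on {0..} \<gamma>" "\<gamma> ` {0..} \<subseteq> V 1" "bounded_var \<gamma> 0 (c * u)" and u: "0 \<le> u"
  shows "dilation n V (1 / c) (lie_integral n br V \<gamma> 0 (c * u)) = lie_integral n br V (rescaled \<gamma> c) 0 u"
  unfolding dilation_def lie_integral_def
proof (intro sum.cong refl)
  fix k assume k: "k \<in> {1..n}"
  have "layer_part n V k (\<Sum>i=1..n. lie_integral_part br V \<gamma> 0 (c * u) i) = lie_integral_part br V \<gamma> 0 (c * u) k"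
    using k lie_rec_in_layer[OF lie_T_in_layer]
    by (intro layer_part_sum) (auto simp: lie_integral_part_def)
  then show "(1 / c) ^ k *\<^sub>R layer_part n V k (\<Sum>i=1..n. lie_integral_part br V \<gamma> 0 (c * u) i)
      = lie_integral_part br V (rescaled \<gamma> c) 0 u k"
    using lie_integral_part_rescaled[OF assms] by simp
qed

lemma (in graded_lie_algebra) continuous_uniform_limit_lie_integral_part:
  fixes \<gamma>s :: "'i \<Rightarrow> real \<Rightarrow> 'a"
  assumes b: "0 \<le> b" and \<gamma>: "continuous_on {0..b} \<gamma>" "variation \<gamma> 0 b \<le> ennreal M" "\<gamma> ` {0..b} \<subseteq> V 1"
    and \<gamma>s: "\<And>j. continuous_on {0..b} (\<gamma>s j)" "\<And>j. variation (\<gamma>s j) 0 b \<le> ennreal M" "\<And>j. \<gamma>s j ` {0..b} \<subseteq> V 1"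
    and M: "0 \<le> M" and lim: "uniform_limit {0..b} \<gamma>s \<gamma> \<F>"
  shows "continuous_uniform_limit {0..b} (\<lambda>j u. lie_integral_part br V (\<gamma>s j) 0 u k)
    (\<lambda>u. lie_integral_part br V \<gamma> 0 u k) \<F>"
  unfolding lie_integral_part_def
proof (rule continuous_uniform_limit_lie_rec[OF finite_dim_bilinear_imp_bounded_bilinear[OF finite_dim bilinear]])
  fix i
  obtain \<psi> :: "'a \<Rightarrow> 'a \<Rightarrow> real" where \<psi>: "\<And>e. bounded_linear (\<psi> e)"
    and T: "\<And>br (\<gamma> :: real \<Rightarrow> 'a) a t i. a \<le> t \<Longrightarrow> \<gamma> ` {a..t} \<subseteq> V 1 \<Longrightarrow> lie_T br (V 1) \<gamma> a t i =
       (\<Sum>w | set w \<subseteq> some_basis (V 1) \<and> length w = Suc i. iter_integral \<gamma> a t (map \<psi> w) *\<^sub>R left_bracket br w)"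
    using lie_T_bounded_linear_coordinates[OF finite_dim subspace_layer[of 1]] by auto
  have \<psi>w: "bounded_linear \<phi>" if "\<phi> \<in> set (map \<psi> w)" for \<phi> w
    using that \<psi> by auto
  have "continuous_uniform_limit {0..b} (\<lambda>j u. iter_integral (\<gamma>s j) 0 u (map \<psi> w)) (\<lambda>u. iter_integral \<gamma> 0 u (map \<psi> w)) \<F>" for w
    unfolding continuous_uniform_limit_def
    by (intro conjI uniform_limit_iter_integral[OF b \<gamma>(1,2) \<gamma>s(1,2) M lim]
      continuous_on_iter_integral[OF \<gamma>(1,2) M]; rule \<psi>w; assumption)
  then have "continuous_uniform_limit {0..b}
     (\<lambda>j u. \<Sum>w | set w \<subseteq> some_basis (V 1) \<and> length w = Suc i. iter_integral (\<gamma>s j) 0 u (map \<psi> w) *\<^sub>R left_bracket br w)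
     (\<lambda>u. \<Sum>w | set w \<subseteq> some_basis (V 1) \<and> length w = Suc i. iter_integral \<gamma> 0 u (map \<psi> w) *\<^sub>R left_bracket br w) \<F>"
    by (intro continuous_uniform_limit_sum continuous_uniform_limit_bounded_linear[OF bounded_linear_scaleR_left])
  then have lim_sum: "uniform_limit {0..b}
     (\<lambda>j u. \<Sum>w | set w \<subseteq> some_basis (V 1) \<and> length w = Suc i. iter_integral (\<gamma>s j) 0 u (map \<psi> w) *\<^sub>R left_bracket br w)
     (\<lambda>u. \<Sum>w | set w \<subseteq> some_basis (V 1) \<and> length w = Suc i. iter_integral \<gamma> 0 u (map \<psi> w) *\<^sub>R left_bracket br w) \<F>"
    and cont_sum: "continuous_on {0..b}
     (\<lambda>u. \<Sum>w | set w \<subseteq> some_basis (V 1) \<and> length w = Suc i. iter_integral \<gamma> 0 u (map \<psi> w) *\<^sub>R left_bracket br w)"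
    by (simp_all only: continuous_uniform_limit_def)
  \<comment> \<open>The expansion of \<open>lie_T\<close> is available for paths inside
    \<open>V 1\<close> and endpoints not before the start; it is therefore inserted pointwise on
    \<open>{0..b}\<close>.\<close>
  have sub: "\<gamma>s j ` {0..u} \<subseteq> V 1" "\<gamma> ` {0..u} \<subseteq> V 1" "0 \<le> u" if "u \<in> {0..b}" for j u
    using \<gamma>(3) \<gamma>s(3)[of j] that by auto
  have "uniform_limit {0..b} (\<lambda>j u. lie_T br (V 1) (\<gamma>s j) 0 u i) (\<lambda>u. lie_T br (V 1) \<gamma> 0 u i) \<F>"
    using lim_sum by (rule uniform_limit_cong'[THEN iffD2, rotated -1]) (rule T; erule sub)+
  moreover have "continuous_on {0..b} (\<lambda>u. lie_T br (V 1) \<gamma> 0 u i)"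
    using cont_sum by (rule continuous_on_cong[THEN iffD2, rotated -1, OF _ refl]) (rule T; erule sub)
  ultimately show "continuous_uniform_limit {0..b} (\<lambda>j u. lie_T br (V 1) (\<gamma>s j) 0 u i) (\<lambda>u. lie_T br (V 1) \<gamma> 0 u i) \<F>"
    by (simp add: continuous_uniform_limit_def)
qed simp

text \<open>For an arbitrary metric inducing the topology, \<open>h\<close> need not be uniformly
  continuous. Compactness of the image of the limit path gives one radius that works around all its
  points.\<close>

lemma uniform_limit_continuous_map_metric:
  fixes f :: "'i \<Rightarrow> 'b \<Rightarrow> 'a::metric_space"
  assumes h: "continuous_map euclidean (Metric_space.mtopology C d) h" and d: "Metric_space C d"
    and K: "compact (l ` K)" and lim: "uniform_limit K f l \<F>" and \<epsilon>: "0 < \<epsilon>"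
  shows "\<forall>\<^sub>F j in \<F>. \<forall>u\<in>K. d (h (f j u)) (h (l u)) < \<epsilon>"
proof -
  interpret Metric_space C d by (rule d)
  have hC: "h x \<in> C" for x using h by (auto simp: continuous_map_def)
  define U where "U x = {y. h y \<in> mball (h x) (\<epsilon>/2)}" for x
  have "open (U x)" for x
    using openin_continuous_map_preimage[OF h openin_mball, of "h x" "\<epsilon>/2"] by (simp add: U_def)
  then have opn: "open G" if "G \<in> range U" for G using that by auto
  have "x \<in> U x" for x using hC \<epsilon> by (simp add: U_def)
  then have cover: "l ` K \<subseteq> \<Union>(range U)" by blast
  \<comment> \<open>A Lebesgue number of the cover by preimages of balls of radius
    \<open>\<epsilon>/2\<close>: both points then lie in one preimage, and the triangle inequality
    runs through its centre.\<close>
  obtain \<delta> where \<delta>: "0 < \<delta>" "\<And>x. x \<in> l ` K \<Longrightarrow> \<exists>G\<in>range U. ball x \<delta> \<subseteq> G"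
    using Heine_Borel_lemma[OF K cover opn] by metis
  show ?thesis
    using uniform_limitD[OF lim \<delta>(1)]
  proof eventually_elim
    case (elim j)
    show ?case
    proof
      fix u assume u: "u \<in> K"
      then obtain x where x: "ball (l u) \<delta> \<subseteq> U x" using \<delta>(2) by blast
      have "f j u \<in> ball (l u) \<delta>" "l u \<in> ball (l u) \<delta>"
        using elim u \<delta>(1) by (auto simp: dist_commute)
      then have "d (h x) (h (f j u)) < \<epsilon>/2" "d (h x) (h (l u)) < \<epsilon>/2"
        using x by (auto simp: U_def subset_iff)
      then show "d (h (f j u)) (h (l u)) < \<epsilon>"
        using triangle[OF hC[of "f j u"] hC[of x] hC[of "l u"]] commute[of "h (f j u)" "h x"] by simp
    qed
  qed
qed

lemma uniform_limit_imp_SUP_tendsto_0: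
  fixes f :: "'i \<Rightarrow> 'b \<Rightarrow> 'a::real_normed_vector"
  assumes "uniform_limit S f l \<F>"
  shows "((\<lambda>j. SUP u\<in>S. ennreal (norm (f j u - l u))) \<longlongrightarrow> 0) \<F>"
proof (rule order_tendstoI)
  fix e :: ennreal assume "0 < e"
  \<comment> \<open>A supremum of terms below \<open>r\<close> is only at most \<open>r\<close>, so
    \<open>r\<close> is taken strictly below \<open>e\<close>; this also makes it finite when
    \<open>e\<close> is infinite.\<close>
  from dense[OF this] obtain y where y: "0 < y" "y < e" by blast
  then obtain r where "y = ennreal r" by (cases y) auto
  with y have r: "0 < r" "ennreal r < e" by auto
  show "\<forall>\<^sub>F j in \<F>. (SUP u\<in>S. ennreal (norm (f j u - l u))) < e"
    using uniform_limitD[OF assms r(1)]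
  proof eventually_elim
    case (elim j)
    then have "(SUP u\<in>S. ennreal (norm (f j u - l u))) \<le> ennreal r"
      by (intro SUP_least ennreal_leI) (auto simp: dist_norm intro: less_imp_le)
    with r(2) show ?case by (rule le_less_trans[rotated])
  qed
qed simp

theorem theorem3p4:
  fixes n :: nat
    and br :: "'a::real_normed_vector \<Rightarrow> 'a \<Rightarrow> 'a"
    and V :: "nat \<Rightarrow> 'a set"
    and G :: "('g, 'x) monoid_scheme"
    and X :: "'g topology"
    and Exp :: "'a \<Rightarrow> 'g"
    and l linf :: "real \<Rightarrow> 'a"
    and T :: "nat \<Rightarrow> real"
  assumes "graded_lie_group n br V G X Exp"
    and "continuous_on {0..} l"
    and "l ` {0..} \<subseteq> V 1"
    and "\<And>a b. 0 \<le> a \<Longrightarrow> a \<le> b \<Longrightarrow> bounded_var l a b"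
    and "\<And>j. 0 < T j"
    and "filterlim T at_top sequentially"
    and "macroscopic_path V l T linf"
  shows
    "(\<forall>d. Metric_space (carrier G) d \<and> Metric_space.mtopology (carrier G) d = X \<longrightarrow>
        (\<forall>\<epsilon>>0. \<forall>\<^sub>F j in sequentially. \<forall>u\<in>{0..1}.
           d (group_dilation n V Exp (1 / T j) (developed_path n br V Exp l (T j * u)))
             (developed_path n br V Exp linf u) < \<epsilon>))
     \<and> (\<forall>k\<in>{1..n}. 
          (\<lambda>j. SUP u\<in>{0..1}. ennreal (norm
             (lie_integral_part br V l 0 (T j * u) k /\<^sub>R T j ^ k
               - lie_integral_part br V linf 0 u k))) \<longlonglongrightarrow> 0)
     \<and> (\<lambda>j. dilation n V (1 / T j) (lie_integral n br V l 0 (T j)))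
          \<longlonglongrightarrow> lie_integral n br V linf 0 1
     \<and> limitin X (\<lambda>j. group_dilation n V Exp (1 / T j) (developed_path n br V Exp l (T j)))
          (Exp (lie_integral n br V linf 0 1)) sequentially
     \<and> Exp (lie_integral n br V linf 0 1) = developed_path n br V Exp linf 1
     \<and> cone_limit_point n V X Exp T (\<lambda>j. developed_path n br V Exp l (T j))
          (Exp (lie_integral n br V linf 0 1))"
proof -
  interpret graded_lie_group n br V G X Exp by (rule assms(1))
  have hom: "continuous_map euclidean X Exp"
    using homeomorphic by (rule homeomorphic_imp_continuous_map)
  have inj: "inj Exp"
    using homeomorphic_imp_injective_map[OF homeomorphic] by simp
  have cone: "group_dilation n V Exp r (Exp x) = Exp (dilation n V r x)" for r x
    by (simp add: group_dilation_def inv_into_f_f[OF inj])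
  define ls where "ls j = rescaled l (T j)" for j
  note macro = assms(7)[unfolded macroscopic_path_def, folded ls_def]
  have ls_cont: "continuous_on {0..1} (ls j)" for j
    unfolding ls_def rescaled_def using assms(5)[of j]
    by (intro continuous_intros continuous_on_compose2[OF assms(2)]) auto
  have ls_V: "ls j ` {0..1} \<subseteq> V 1" for j
    using assms(3) less_imp_le[OF assms(5)[of j]]
    by (auto simp: ls_def rescaled_def intro!: subspace_scale subspace_diff subspace_layer)
  \<comment> \<open>One constant for all rescaled paths and for the limit path, as the stability
    result wants a common bound; \<open>macroscopic_path\<close> makes both entries of the maximum
    finite.\<close>
  define M where "M = enn2real (max (SUP j. variation (ls j) 0 1) (variation linf 0 1))"
  have "max (SUP j. variation (ls j) 0 1) (variation linf 0 1) < \<infinity>"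
    using macro by (simp add: bounded_var_def)
  then have M: "ennreal M = max (SUP j. variation (ls j) 0 1) (variation linf 0 1)"
    unfolding M_def by (intro ennreal_enn2real) (simp only: infinity_ennreal_def)
  have var: "variation (ls j) 0 1 \<le> ennreal M" "variation linf 0 1 \<le> ennreal M" for j
    unfolding M by (rule max.coboundedI1, rule SUP_upper, rule UNIV_I, rule max.cobounded2)
  have part: "continuous_uniform_limit {0..1} (\<lambda>j u. lie_integral_part br V (ls j) 0 u k)
      (\<lambda>u. lie_integral_part br V linf 0 u k) sequentially" for k
    using macro ls_cont ls_V var
    by (intro continuous_uniform_limit_lie_integral_part[where M = M]) (auto simp: M_def)
  then have "continuous_uniform_limit {0..1} (\<lambda>j u. lie_integral n br V (ls j) 0 u)
      (\<lambda>u. lie_integral n br V linf 0 u) sequentially"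
    unfolding lie_integral_def by (intro continuous_uniform_limit_sum)
  then have lim: "uniform_limit {0..1} (\<lambda>j u. lie_integral n br V (ls j) 0 u)
      (\<lambda>u. lie_integral n br V linf 0 u) sequentially"
    and cont: "continuous_on {0..1} (\<lambda>u. lie_integral n br V linf 0 u)"
    by (simp_all add: continuous_uniform_limit_def)
  have bv: "bounded_var l 0 (T j * u)" if "0 \<le> u" for j u
    using assms(4)[of 0 "T j * u"] less_imp_le[OF assms(5)[of j]] that by simp
  have part_scaled: "lie_integral_part br V l 0 (T j * u) k /\<^sub>R T j ^ k = lie_integral_part br V (ls j) 0 u k"
    if "0 \<le> u" for j u k
    using lie_integral_part_rescaled[OF assms(5)[of j] assms(2,3) bv[OF that] that, of k]
    by (simp add: ls_def divide_inverse power_inverse)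
  have dil: "dilation n V (1 / T j) (lie_integral n br V l 0 (T j * u)) = lie_integral n br V (ls j) 0 u"
    if "0 \<le> u" for j u
    using dilation_lie_integral[OF assms(5)[of j] assms(2,3) bv[OF that] that] by (simp add: ls_def)
  have dil_path: "group_dilation n V Exp (1 / T j) (developed_path n br V Exp l (T j * u))
      = Exp (lie_integral n br V (ls j) 0 u)" if "0 \<le> u" for j u
    by (simp only: developed_path_def cone dil[OF that])
  have endpoint: "(\<lambda>j. lie_integral n br V (ls j) 0 1) \<longlonglongrightarrow> lie_integral n br V linf 0 1"
    by (rule tendsto_uniform_limitI[OF lim]) simp
  have uniform: "\<forall>\<^sub>F j in sequentially. \<forall>u\<in>{0..1}.
       d (group_dilation n V Exp (1 / T j) (developed_path n br V Exp l (T j * u)))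
         (developed_path n br V Exp linf u) < \<epsilon>"
    if d: "Metric_space (carrier G) d" "Metric_space.mtopology (carrier G) d = X" and \<epsilon>: "0 < \<epsilon>" for d \<epsilon>
  proof -
    have "compact ((\<lambda>u. lie_integral n br V linf 0 u) ` {0..1})"
      using cont by (rule compact_continuous_image) simp
    from uniform_limit_continuous_map_metric[OF hom[folded d(2)] d(1) this lim \<epsilon>]
    show ?thesis by eventually_elim (simp add: dil_path developed_path_def[of _ _ _ _ linf])
  qed
  have parts: "(\<lambda>j. SUP u\<in>{0..1}. ennreal (norm
       (lie_integral_part br V l 0 (T j * u) k /\<^sub>R T j ^ k - lie_integral_part br V linf 0 u k))) \<longlonglongrightarrow> 0" for k
  proof -
    have "(\<lambda>j. SUP u\<in>{0..1}. ennreal (norm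
       (lie_integral_part br V (ls j) 0 u k - lie_integral_part br V linf 0 u k))) \<longlonglongrightarrow> 0"
      using part[of k] by (intro uniform_limit_imp_SUP_tendsto_0) (simp add: continuous_uniform_limit_def)
    moreover have "(SUP u\<in>{0..1}. ennreal (norm
         (lie_integral_part br V l 0 (T j * u) k /\<^sub>R T j ^ k - lie_integral_part br V linf 0 u k)))
       = (SUP u\<in>{0..1}. ennreal (norm
         (lie_integral_part br V (ls j) 0 u k - lie_integral_part br V linf 0 u k)))" for j
      by (intro SUP_cong refl, subst part_scaled) auto
    ultimately show ?thesis by (simp only:)
  qed
  have group_lim: "limitin X (\<lambda>j. group_dilation n V Exp (1 / T j) (developed_path n br V Exp l (T j)))
      (Exp (lie_integral n br V linf 0 1)) sequentially"
  proof -
    have "limitin X (Exp \<circ> (\<lambda>j. lie_integral n br V (ls j) 0 1)) (Exp (lie_integral n br V linf 0 1)) sequentially"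
      using endpoint by (intro continuous_map_limit[OF hom]) simp
    then show ?thesis using dil_path[of 1] by (simp add: o_def)
  qed
  show ?thesis
    using uniform parts endpoint group_lim dil[of 1]
    by (simp add: cone_limit_point_def developed_path_def[of _ _ _ _ linf])
qed

end
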